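(* Let $X,Y$ be Banach spaces over $\mathbb{K}$ and let $\Phi,\Upsilon,\Psi\in\ell_\infty(B_X,Y)$ with $\|\Phi\|=\|\Upsilon\|=\|\Psi\|=1$. Assume that $Y$ has the alternative $\Phi$-Daugavet property with respect to $Y^*\Upsilon\cdot Y$. If $\mathcal{S}'_\Psi<\mathcal{S}'_\Upsilon$ (that is, $\Psi$ is weakly slice continuous with respect to $\Upsilon$) and $\Psi$ is weakly compact, then $$\max_{|\omega|=1}\|\Phi+\omega\Psi\|=2.$$
   Context: $\mathbb{K}$ is $\mathbb{R}$ or $\mathbb{C}$; in $\max_{|\omega|=1}$ the variable $\omega$ runs over scalars in $\mathbb{K}$ of modulus $1$. $B_X$ is the closed unit ball of $X$, and $Y^*$ is the dual of $Y$. $\ell_\infty(B_X,Y)$ is the space of all bounded (not necessarily linear or continuous) maps $\Phi:B_X\to Y$ with $\|\Phi\|=\sup_{x\in B_X}\|\Phi(x)\|$; $\ell_\infty(B_X)=\ell_\infty(B_X,\mathbb{K})$. For $x'\in\ell_\infty(B_X)$ and $y\in Y$, $x'\otimes y$ is the map $x\mapsto x'(x)y$. For $y^*\in Y^*$, $y^*\Phi=y^*\circ\Phi$, and $Y^*\Upsilon\cdot Y=\{y^*\Upsilon\otimes y: y^*\in Y^*,\ y\in Y\}$. $Y$ has the alternative $\Phi$-Daugavet property with respect to $V\subset\ell_\infty(B_X,Y)$ if $\max_{|\omega|=1}\|\Phi+\omega\Theta\|=\|\Phi\|+\|\Theta\|$ for all $\Theta\in V$. For $x'\in\ell_\infty(B_X)$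 with $\|x'\|=1$ and $\varepsilon>0$, the weak slice is $S'(x',\varepsilon)=\{x\in B_X:|x'(x)|\ge1-\varepsilon\}$. For $y^*\in Y^*$ with $y^*\Phi\ne0$, $\Phi_{y^*}=\frac{1}{\|y^*\Phi\|}\,y^*\Phi$. $\mathcal{S}'_\Phi=\{S'(\Phi_{y^*},\varepsilon):0<\varepsilon<1,\ y^*\in Y^*,\ y^*\Phi\ne0\}$. $\mathcal{S}'_\Psi<\mathcal{S}'_\Phi$ means: for every $S'(\Psi_{z^*},\varepsilon)\in\mathcal{S}'_\Psi$ there is $S'(\Phi_{y^*},\mu)\in\mathcal{S}'_\Phi$ with $S'(\Phi_{y^*},\mu)\subset S'(\Psi_{z^*},\varepsilon)$. $\Psi\in\ell_\infty(B_X,Y)$ is weakly compact if the weak closure of $\Psi(B_X)$ is a weakly compact set. *)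

theory Defs
  imports "HOL-Analysis.Analysis"
begin

text \<open>The scalar field K is \<open>\<real>\<close> or \<open>\<complex>\<close>: the class consists of the normed fields that are
  isometrically isomorphic to one of the two, so that a type variable of this class ranges over
  both cases.\<close>

class real_or_complex = real_normed_field +
  assumes real_or_complex:
    "\<exists>f :: 'a \<Rightarrow> complex.
       (\<forall>x y. f (x + y) = f x + f y) \<and> (\<forall>x y. f (x * y) = f x * f y) \<and>
       (\<forall>x. norm (f x) = norm x) \<and> (range f = \<real> \<or> range f = UNIV)"

instance real :: real_or_complex
  by standard (rule exI[of _ complex_of_real], auto simp: Reals_def)

instance complex :: real_or_complex
  by standard (rule exI[of _ id], auto)

text \<open>The class \<open>banach\<close> supplies the underlying real Banach space; the locale adds the
  multiplication by scalars from K.\<close>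

locale K_banach = vector_space smul
  for smul :: "'k::real_or_complex \<Rightarrow> 'v::banach \<Rightarrow> 'v" +
  assumes scale_of_real: "smul (of_real r) v = r *\<^sub>R v"
    and norm_scale: "norm (smul c v) = norm c * norm v"

lemma K_banach_real: "K_banach (scaleR :: real \<Rightarrow> 'v::banach \<Rightarrow> 'v)"
  by unfold_locales (auto simp: algebra_simps)

lemma K_banach_complex: "K_banach ((*) :: complex \<Rightarrow> complex \<Rightarrow> complex)"
  by unfold_locales (auto simp: algebra_simps norm_mult scaleR_conv_of_real)

definition dual_space :: "('k::real_or_complex \<Rightarrow> 'v::banach \<Rightarrow> 'v) \<Rightarrow> ('v \<Rightarrow> 'k) set" where
  "dual_space smul =
     {f. Vector_Spaces.linear smul (*) f \<and> (\<exists>C. \<forall>v. norm (f v) \<le> C * norm v)}"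

definition weak_topology :: "('k::real_or_complex \<Rightarrow> 'v::banach \<Rightarrow> 'v) \<Rightarrow> 'v topology" where
  "weak_topology smul = topology_generated_by {f -` U |f U. f \<in> dual_space smul \<and> open U}"

text \<open>A map on the closed unit ball is represented by a function on the whole space; every notion
  below depends only on its values on \<open>cball 0 1\<close>.\<close>

definition linfty :: "('x::banach \<Rightarrow> 'v::real_normed_vector) set" where
  "linfty = {F. bounded (F ` cball 0 1)}"

definition linfty_norm :: "('x::banach \<Rightarrow> 'v::real_normed_vector) \<Rightarrow> real" where
  "linfty_norm F = (SUP x\<in>cball 0 1. norm (F x))"

text \<open>\<open>has_max A m\<close>: the maximum of \<open>A\<close> is attained and equals \<open>m\<close>
  (\<open>Max\<close> is meaningful for finite sets only).\<close>

definition has_max :: "real set \<Rightarrow> real \<Rightarrow> bool" where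
  "has_max A m \<longleftrightarrow> m \<in> A \<and> (\<forall>a\<in>A. a \<le> m)"

definition rotated_norms ::
  "('k::real_or_complex \<Rightarrow> 'y::banach \<Rightarrow> 'y) \<Rightarrow> ('x::banach \<Rightarrow> 'y) \<Rightarrow> ('x \<Rightarrow> 'y) \<Rightarrow> real set" where
  "rotated_norms smul \<Phi> \<Theta> =
     {linfty_norm (\<lambda>x. \<Phi> x + smul \<omega> (\<Theta> x)) |\<omega>. norm \<omega> = 1}"

definition alternative_Daugavet ::
  "('k::real_or_complex \<Rightarrow> 'y::banach \<Rightarrow> 'y) \<Rightarrow> ('x::banach \<Rightarrow> 'y) \<Rightarrow> ('x \<Rightarrow> 'y) set \<Rightarrow> bool" where
  "alternative_Daugavet smul \<Phi> V \<longleftrightarrow>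
     (\<forall>\<Theta>\<in>V. has_max (rotated_norms smul \<Phi> \<Theta>) (linfty_norm \<Phi> + linfty_norm \<Theta>))"

definition tensor ::
  "('k::real_or_complex \<Rightarrow> 'y::banach \<Rightarrow> 'y) \<Rightarrow> ('x::banach \<Rightarrow> 'k) \<Rightarrow> 'y \<Rightarrow> 'x \<Rightarrow> 'y" where
  "tensor smul x' y = (\<lambda>x. smul (x' x) y)"

definition dual_tensors ::
  "('k::real_or_complex \<Rightarrow> 'y::banach \<Rightarrow> 'y) \<Rightarrow> ('x::banach \<Rightarrow> 'y) \<Rightarrow> ('x \<Rightarrow> 'y) set" where
  "dual_tensors smul \<Upsilon> = {tensor smul (ys \<circ> \<Upsilon>) y |ys y. ys \<in> dual_space smul}"

definition weak_slice :: "('x::banach \<Rightarrow> 'k::real_or_complex) \<Rightarrow> real \<Rightarrow> 'x set" where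
  "weak_slice x' \<epsilon> = {x \<in> cball 0 1. norm (x' x) \<ge> 1 - \<epsilon>}"

definition normalized ::
  "('x::banach \<Rightarrow> 'y::banach) \<Rightarrow> ('y \<Rightarrow> 'k::real_or_complex) \<Rightarrow> 'x \<Rightarrow> 'k" where
  "normalized \<Phi> ys = (\<lambda>x. (1 / linfty_norm (ys \<circ> \<Phi>)) *\<^sub>R ys (\<Phi> x))"

definition weak_slices ::
  "('k::real_or_complex \<Rightarrow> 'y::banach \<Rightarrow> 'y) \<Rightarrow> ('x::banach \<Rightarrow> 'y) \<Rightarrow> 'x set set" where
  "weak_slices smul \<Phi> =
     {weak_slice (normalized \<Phi> ys) \<epsilon> |ys \<epsilon>.
        0 < \<epsilon> \<and> \<epsilon> < 1 \<and> ys \<in> dual_space smul \<and> (\<exists>x\<in>cball 0 1. ys (\<Phi> x) \<noteq> 0)}"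

text \<open>\<open>weakly_slice_continuous smul \<Psi> \<Phi>\<close> is the relation \<open>S'\<^sub>\<Psi> < S'\<^sub>\<Phi>\<close>.\<close>

definition weakly_slice_continuous ::
  "('k::real_or_complex \<Rightarrow> 'y::banach \<Rightarrow> 'y) \<Rightarrow> ('x::banach \<Rightarrow> 'y) \<Rightarrow> ('x \<Rightarrow> 'y) \<Rightarrow> bool" where
  "weakly_slice_continuous smul \<Psi> \<Phi> \<longleftrightarrow>
     (\<forall>S\<in>weak_slices smul \<Psi>. \<exists>T\<in>weak_slices smul \<Phi>. T \<subseteq> S)"

definition weakly_compact_map ::
  "('k::real_or_complex \<Rightarrow> 'y::banach \<Rightarrow> 'y) \<Rightarrow> ('x::banach \<Rightarrow> 'y) \<Rightarrow> bool" where
  "weakly_compact_map smul \<Psi> \<longleftrightarrow>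
     compactin (weak_topology smul) (weak_topology smul closure_of (\<Psi> ` cball 0 1))"

end

(* By weak compactness, the circled weak closure A of the range of Psi has slices of arbitrarily
   small diameter around points of norm close to 1. Such a slice is cut out by a functional z*, so on
   some weak slice of Psi the values of Psi are, up to rotation, close to a single vector d. By weak
   slice continuity it contains a weak slice of Upsilon, and the alternative Daugavet property,
   applied to a rank-one map in the direction of d, yields a point x of that slice and a rotation of
   d such that Phi x plus the rotated d has norm close to 2. Since d is close to a rotation of
   Psi x, the supremum over the unit circle is 2; it is attained because the circle is compact. *)

theory Submission
  imports Defs
begin

subsection \<open>The Hahn--Banach theorem\<close>

text \<open>The circled set A is in general not convex, and a slice must be cut out by a single
  functional. Fragmentation by the norm only gives small weakly open pieces. To pass to slices it is
  applied to a minimal closed subset that still carries the maxima of all functionals on A; a piece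
  removed from that subset is detected by some functional.

  That part involves real functionals only, so Hahn-Banach is proved over the reals, and the scalars
  of K enter when a real functional is lifted to a K-linear one.

  The range is circled because a weak slice bounds only the modulus of a functional. The rotation
  that makes \<open>F (\<Psi> x)\<close> nonnegative keeps the rotated value inside A, so one real
  slice of A controls a whole weak slice of \<open>\<Psi>\<close>. This rotation depends on x, and
  so does the phase coming from the rank-one map. Both are harmless because the final estimate is
  made at one point x, where they multiply to a single unimodular scalar.\<close>

definition sublinear :: "('a::real_vector \<Rightarrow> real) \<Rightarrow> bool" where
  "sublinear q \<longleftrightarrow> (\<forall>x y. q (x + y) \<le> q x + q y) \<and> (\<forall>t>0. \<forall>x. q (t *\<^sub>R x) \<le> t * q x)"

lemma sublinear_add: "sublinear q \<Longrightarrow> q (x + y) \<le> q x + q y"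
  by (simp add: sublinear_def)

lemma sublinear_zero:
  assumes "sublinear q" shows "q 0 = 0"
proof -
  have *: "q (t *\<^sub>R 0) \<le> t * q 0" if "t > 0" for t
    using assms that unfolding sublinear_def by blast
  show ?thesis using *[of 2] *[of "1/2"] by simp
qed

lemma sublinear_scaleR:
  assumes "sublinear q" "t \<ge> 0" shows "q (t *\<^sub>R x) = t * q x"
proof (cases "t = 0")
  case True then show ?thesis using sublinear_zero[OF assms(1)] by simp
next
  case False
  then have t: "t > 0" using assms by simp
  have *: "q (s *\<^sub>R y) \<le> s * q y" if "s > 0" for s y
    using assms(1) that unfolding sublinear_def by blast
  have "q x \<le> (1/t) * q (t *\<^sub>R x)"
    using *[of "1/t" "t *\<^sub>R x"] t by simp
  then have "t * q x \<le> q (t *\<^sub>R x)" using t by (simp add: field_simps)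
  with *[OF t, of x] show ?thesis by simp
qed

lemma sublinear_lower:
  assumes "sublinear q" shows "- q (- x) \<le> q x"
  using sublinear_add[OF assms, of x "- x"] sublinear_zero[OF assms] by simp

text \<open>By homogeneity, \<open>q (x + t *\<^sub>R y) - t * q y\<close> is the difference
  quotient of \<open>q\<close> at \<open>y\<close> in direction \<open>x\<close> with step 1/t. It
  decreases in t, so its infimum is the one-sided directional derivative of \<open>q\<close> at
  \<open>y\<close>.\<close>

lemma sublinear_slope:
  assumes q: "sublinear q"
  obtains q' where "sublinear q'" "\<And>x. q' x \<le> q x" "\<And>x. q' x \<le> q (x + y) - q y"
proof -
  define q' where "q' x = (INF t\<in>{0..}. q (x + t *\<^sub>R y) - t * q y)" for x
  have bdd: "bdd_below ((\<lambda>t. q (x + t *\<^sub>R y) - t * q y) ` {0..})" for x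
  proof (rule bdd_belowI2)
    fix t :: real assume "t \<in> {0..}"
    then have "t * q y = q (t *\<^sub>R y)" using sublinear_scaleR[OF q] by simp
    also have "\<dots> \<le> q (x + t *\<^sub>R y) + q (- x)"
      using sublinear_add[OF q, of "x + t *\<^sub>R y" "- x"] by simp
    finally show "- q (- x) \<le> q (x + t *\<^sub>R y) - t * q y" by simp
  qed
  have upper: "q' x \<le> q (x + t *\<^sub>R y) - t * q y" if "t \<ge> 0" for x t
    unfolding q'_def by (rule cINF_lower[OF bdd]) (use that in simp)
  have "sublinear q'"
    unfolding sublinear_def
  proof (intro conjI allI impI)
    fix u v
    have "q' (u + v) - q' u \<le> q (v + t *\<^sub>R y) - t * q y" if t: "t \<in> {0..}" for t
    proof -
      have "q' (u + v) - (q (v + t *\<^sub>R y) - t * q y) \<le> q (u + s *\<^sub>R y) - s * q y"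
        if s: "s \<in> {0..}" for s
      proof -
        have "q' (u + v) \<le> q ((u + v) + (s + t) *\<^sub>R y) - (s + t) * q y"
          using s t by (intro upper) simp
        also have "(u + v) + (s + t) *\<^sub>R y = (u + s *\<^sub>R y) + (v + t *\<^sub>R y)"
          by (simp add: algebra_simps)
        also have "q \<dots> \<le> q (u + s *\<^sub>R y) + q (v + t *\<^sub>R y)" by (rule sublinear_add[OF q])
        finally show ?thesis by (simp add: algebra_simps)
      qed
      then have "q' (u + v) - (q (v + t *\<^sub>R y) - t * q y) \<le> q' u"
        unfolding q'_def[of u] by (intro cINF_greatest) auto
      then show ?thesis by simp
    qed
    then have "q' (u + v) - q' u \<le> q' v"
      unfolding q'_def[of v] by (intro cINF_greatest) auto
    then show "q' (u + v) \<le> q' u + q' v" by simp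
  next
    fix t :: real and x assume t: "t > 0"
    have "q' (t *\<^sub>R x) / t \<le> q (x + s *\<^sub>R y) - s * q y" if s: "s \<in> {0..}" for s
    proof -
      have "q' (t *\<^sub>R x) \<le> q (t *\<^sub>R x + (t * s) *\<^sub>R y) - (t * s) * q y"
        using s t by (intro upper) simp
      also have "t *\<^sub>R x + (t * s) *\<^sub>R y = t *\<^sub>R (x + s *\<^sub>R y)" by (simp add: algebra_simps)
      also have "q \<dots> = t * q (x + s *\<^sub>R y)" using t sublinear_scaleR[OF q] by simp
      finally show ?thesis using t by (simp add: field_simps)
    qed
    then have "q' (t *\<^sub>R x) / t \<le> q' x"
      unfolding q'_def[of x] by (intro cINF_greatest) auto
    then show "q' (t *\<^sub>R x) \<le> t * q' x" using t by (simp add: field_simps)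
  qed
  moreover have "q' x \<le> q x" for x using upper[of 0 x] by simp
  moreover have "q' x \<le> q (x + y) - q y" for x using upper[of 1 x] by simp
  ultimately show ?thesis using that by blast
qed

lemma minimal_sublinear_exists:
  assumes p: "sublinear p"
  obtains q where "sublinear q" "\<And>x. q x \<le> p x"
    "\<And>q'. sublinear q' \<Longrightarrow> (\<And>x. q' x \<le> q x) \<Longrightarrow> q' = q"
proof -
  define A where "A = {q. sublinear q \<and> (\<forall>x. q x \<le> p x)}"
  \<comment> \<open>The order is reversed, so that the maximal element supplied by Zorn is minimal
    pointwise.\<close>
  let ?P = "\<lambda>q q' :: 'a \<Rightarrow> real. \<forall>x. q' x \<le> q x"
  have "\<exists>m\<in>A. \<forall>a\<in>A. ?P m a \<longrightarrow> a = m"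
  proof (rule predicate_Zorn)
    show "partial_order_on A (relation_of ?P A)"
    proof (rule partial_order_on_relation_ofI)
      show "?P a a" for a by simp
      show "?P a c" if "?P a b" "?P b c" for a b c
        using that by (meson order_trans)
      show "a = b" if "?P a b" "?P b a" for a b
        using that by (intro ext) (meson order_antisym)
    qed
  next
    fix C assume C: "C \<in> Chains (relation_of ?P A)"
    have CA: "C \<subseteq> A" and tot: "\<And>q r. q \<in> C \<Longrightarrow> r \<in> C \<Longrightarrow> ?P q r \<or> ?P r q"
      using C unfolding Chains_def relation_of_def by blast+
    show "\<exists>u\<in>A. \<forall>a\<in>C. ?P a u"
    proof (cases "C = {}")
      case True
      then show ?thesis using p by (auto simp: A_def)
    next
      case False
      define m where "m x = (INF q\<in>C. q x)" for x
      have CS: "sublinear q" "q x \<le> p x" if "q \<in> C" for q x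
        using that CA by (auto simp: A_def)
      have bdd: "bdd_below ((\<lambda>q. q x) ` C)" for x
      proof (rule bdd_belowI2)
        fix q assume "q \<in> C"
        then show "- p (- x) \<le> q x"
          using sublinear_lower[of q x] CS(1)[of q] CS(2)[of q "- x"] by simp
      qed
      have upper: "m x \<le> q x" if "q \<in> C" for q x
        unfolding m_def by (rule cINF_lower[OF bdd that])
      have "sublinear m"
        unfolding sublinear_def
      proof (intro conjI allI impI)
        fix u v
        have "m (u + v) - m u \<le> r v" if r: "r \<in> C" for r
        proof -
          \<comment> \<open>The smaller of the two chain members bounds \<open>m (u + v)\<close> at
            both \<open>u\<close> and \<open>v\<close>; this is where totality of the chain is
            used.\<close>
          have "m (u + v) - r v \<le> q u" if q: "q \<in> C" for q
            using tot[OF q r]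
          proof
            assume "?P q r"
            moreover have "m (u + v) \<le> r u + r v"
              using upper[OF r] sublinear_add[OF CS(1)[OF r]] order_trans by blast
            ultimately show ?thesis using order_trans[of "r u" "q u"] by (smt (verit))
          next
            assume "?P r q"
            moreover have "m (u + v) \<le> q u + q v"
              using upper[OF q] sublinear_add[OF CS(1)[OF q]] order_trans by blast
            ultimately show ?thesis by (smt (verit))
          qed
          then have "m (u + v) - r v \<le> m u"
            unfolding m_def[of u] using False by (intro cINF_greatest) auto
          then show ?thesis by simp
        qed
        then have "m (u + v) - m u \<le> m v"
          unfolding m_def[of v] using False by (intro cINF_greatest) auto
        then show "m (u + v) \<le> m u + m v" by simp
      next
        fix t :: real and x assume t: "t > 0"
        have "m (t *\<^sub>R x) / t \<le> q x" if q: "q \<in> C" for q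
          using upper[OF q, of "t *\<^sub>R x"] sublinear_scaleR[OF CS(1)[OF q], of t x] t
          by (simp add: field_simps)
        then have "m (t *\<^sub>R x) / t \<le> m x"
          unfolding m_def[of x] using False by (intro cINF_greatest) auto
        then show "m (t *\<^sub>R x) \<le> t * m x" using t by (simp add: field_simps)
      qed
      moreover have "m x \<le> p x" for x
        using False upper CS(2) order_trans by blast
      ultimately show ?thesis using upper by (auto simp: A_def)
    qed
  qed
  then obtain q where q: "q \<in> A" "\<And>a. a \<in> A \<Longrightarrow> ?P q a \<Longrightarrow> a = q" by blast
  show ?thesis
  proof (rule that)
    show "sublinear q" "q x \<le> p x" for x using q(1) by (auto simp: A_def)
    fix q' assume q': "sublinear q'" "\<And>x. q' x \<le> q x"
    have "q' x \<le> p x" for x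
      using q'(2)[of x] \<open>q \<in> A\<close> order_trans by (auto simp: A_def)
    then show "q' = q" using q' q(2) by (auto simp: A_def)
  qed
qed

text \<open>The directional derivative of \<open>q\<close> at \<open>y\<close> lies below
  \<open>q\<close>, so by minimality it equals \<open>q\<close>. Its second bound then reads as
  superadditivity.\<close>

lemma minimal_sublinear_linear:
  assumes q: "sublinear q" and min: "\<And>q'. sublinear q' \<Longrightarrow> (\<And>x. q' x \<le> q x) \<Longrightarrow> q' = q"
  shows "linear q"
proof -
  have add: "q (x + y) = q x + q y" for x y
  proof -
    obtain q' where q': "sublinear q'" "\<And>x. q' x \<le> q x" "\<And>x. q' x \<le> q (x + y) - q y"
      using sublinear_slope[OF q] by blast
    then have "q' = q" using min by blast
    then show ?thesis using q'(3)[of x] sublinear_add[OF q, of x y] by simp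
  qed
  have neg: "q (- x) = - q x" for x
    using add[of x "- x"] sublinear_zero[OF q] by simp
  show ?thesis
  proof (rule linearI)
    fix t x
    show "q (t *\<^sub>R x) = t *\<^sub>R q x"
      using sublinear_scaleR[OF q, of t x] sublinear_scaleR[OF q, of "- t" x] neg[of "t *\<^sub>R x"]
      by (cases "t \<ge> 0") auto
  qed (rule add)
qed

theorem Hahn_Banach_sublinear:
  assumes p: "sublinear p"
  obtains g where "linear g" "\<And>x. g x \<le> p x" "g y = p y"
proof -
  \<comment> \<open>Minimizing below the derivative at \<open>y\<close> instead of below
    \<open>p\<close> forces \<open>g (- y) \<le> - p y\<close>, and hence equality at
    \<open>y\<close>.\<close>
  obtain p' where p': "sublinear p'" "\<And>x. p' x \<le> p x" "\<And>x. p' x \<le> p (x + y) - p y"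
    using sublinear_slope[OF p] by blast
  obtain g where g: "sublinear g" "\<And>x. g x \<le> p' x"
    "\<And>q'. sublinear q' \<Longrightarrow> (\<And>x. q' x \<le> g x) \<Longrightarrow> q' = g"
    using minimal_sublinear_exists[OF p'(1)] by blast
  have lin: "linear g" using minimal_sublinear_linear[OF g(1,3)] .
  have le: "g x \<le> p x" for x using g(2) p'(2) order_trans by blast
  have "g (- y) \<le> - p y"
    using g(2)[of "- y"] p'(3)[of "- y"] sublinear_zero[OF p] by simp
  then have "g y = p y"
    using linear_neg[OF lin, of y] le[of y] by simp
  with lin le show ?thesis using that by blast
qed

section \<open>Norming and separating functionals\<close>

lemma linear_le_norm_bounded_linear:
  fixes g :: "'a::real_normed_vector \<Rightarrow> real"
  assumes "linear g" "\<And>x. g x \<le> norm x"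
  shows "bounded_linear g" "\<bar>g x\<bar> \<le> norm x"
proof -
  show *: "\<bar>g x\<bar> \<le> norm x" for x
    using assms(2)[of x] assms(2)[of "- x"] linear_neg[OF assms(1), of x] by simp
  show "bounded_linear g"
    using assms(1) * by (intro bounded_linear_intro[where K = 1]) (auto simp: linear_add linear_scale)
qed

lemma norming_functional:
  fixes y :: "'a::real_normed_vector"
  obtains g where "bounded_linear g" "\<And>x. \<bar>g x\<bar> \<le> norm x" "g y = norm y"
proof -
  have "sublinear (norm :: 'a \<Rightarrow> real)"
    by (auto simp: sublinear_def norm_triangle_ineq)
  then obtain g where "linear g" "\<And>x. g x \<le> norm x" "g y = norm y"
    using Hahn_Banach_sublinear[of norm y] by blast
  then show ?thesis using linear_le_norm_bounded_linear[of g] that by blast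
qed

text \<open>The distance to \<open>Z\<close> is the quotient seminorm. A linear functional below it
  is bounded by the norm and vanishes on \<open>Z\<close>, which is how a point outside a closed
  subspace gets separated.\<close>

lemma sublinear_infdist:
  fixes Z :: "'a::real_normed_vector set"
  assumes Z: "subspace Z"
  shows "sublinear (\<lambda>x. infdist x Z)"
proof -
  have ne: "Z \<noteq> {}" using subspace_0[OF Z] by blast
  have approx: "\<exists>z\<in>Z. dist x z < infdist x Z + e" if "e > 0" for x e
    using cINF_less_iff[of Z "dist x" "infdist x Z + e"] ne that
    by (auto simp: infdist_notempty)
  show ?thesis
    unfolding sublinear_def
  proof (intro conjI allI impI)
    fix x y
    show "infdist (x + y) Z \<le> infdist x Z + infdist y Z"
    proof (rule field_le_epsilon)
      fix e :: real assume "e > 0"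
      then obtain a b where ab: "a \<in> Z" "b \<in> Z"
        "dist x a < infdist x Z + e/2" "dist y b < infdist y Z + e/2"
        using approx[of "e/2"] by (metis half_gt_zero)
      have "infdist (x + y) Z \<le> dist (x + y) (a + b)"
        using ab subspace_add[OF Z] by (intro infdist_le) auto
      also have "\<dots> \<le> dist x a + dist y b" by (rule dist_triangle_add)
      finally show "infdist (x + y) Z \<le> infdist x Z + infdist y Z + e" using ab by simp
    qed
  next
    fix t :: real and x assume t: "t > 0"
    have "infdist (t *\<^sub>R x) Z / t \<le> dist x z" if "z \<in> Z" for z
    proof -
      have "infdist (t *\<^sub>R x) Z \<le> dist (t *\<^sub>R x) (t *\<^sub>R z)"
        using that subspace_scale[OF Z] by (intro infdist_le) auto
      also have "\<dots> = t * dist x z"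
        using t by (simp add: dist_norm flip: scaleR_diff_right)
      finally show ?thesis using t by (simp add: field_simps)
    qed
    then have "infdist (t *\<^sub>R x) Z / t \<le> infdist x Z"
      using ne by (auto simp: infdist_notempty intro!: cINF_greatest)
    then show "infdist (t *\<^sub>R x) Z \<le> t * infdist x Z" using t by (simp add: field_simps)
  qed
qed

lemma separating_functional:
  fixes Z :: "'a::real_normed_vector set"
  assumes Z: "subspace Z" "closed Z" and y: "y \<notin> Z"
  obtains g :: "'a \<Rightarrow> real" where "bounded_linear g" "\<And>z. z \<in> Z \<Longrightarrow> g z = 0" "g y > 0"
proof -
  have ne: "Z \<noteq> {}" and 0: "0 \<in> Z" using subspace_0[OF Z(1)] by auto
  obtain g where g: "linear g" "\<And>x. g x \<le> infdist x Z" "g y = infdist y Z"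
    using Hahn_Banach_sublinear[OF sublinear_infdist[OF Z(1)], of y] by blast
  have "g x \<le> norm x" for x
    using g(2)[of x] infdist_le[OF 0, of x] by simp
  then have "bounded_linear g" using linear_le_norm_bounded_linear g(1) by blast
  moreover have "g z = 0" if "z \<in> Z" for z
    using g(2)[of z] g(2)[of "- z"] that subspace_neg[OF Z(1)] linear_neg[OF g(1), of z] by force
  moreover have "g y > 0"
    using infdist_pos_not_in_closed[OF Z(2) ne y] g(3) by simp
  ultimately show ?thesis by (intro that[of g])
qed

subsection \<open>Weakly compact sets are fragmented by the norm\<close>

lemma subspace_closure:
  fixes Z :: "'a::real_normed_vector set"
  assumes Z: "subspace Z"
  shows "subspace (closure Z)"
proof (rule subspaceI)
  show "0 \<in> closure Z" using subspace_0[OF Z] closure_subset by blast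
  show "x + y \<in> closure Z" if xy: "x \<in> closure Z" "y \<in> closure Z" for x y
  proof -
    obtain u v where "\<And>n. u n \<in> Z" "u \<longlonglongrightarrow> x" "\<And>n. v n \<in> Z" "v \<longlonglongrightarrow> y"
      using xy unfolding closure_sequential by blast
    then have "\<And>n. u n + v n \<in> Z" "(\<lambda>n. u n + v n) \<longlonglongrightarrow> x + y"
      by (auto intro: subspace_add[OF Z] tendsto_intros)
    then show ?thesis unfolding closure_sequential
      by (intro exI[of _ "\<lambda>n. u n + v n"]) simp
  qed
  show "c *\<^sub>R x \<in> closure Z" if "x \<in> closure Z" for c x
  proof -
    obtain u where "\<And>n. u n \<in> Z" "u \<longlonglongrightarrow> x"
      using \<open>x \<in> closure Z\<close> unfolding closure_sequential by blast
    then have "\<And>n. c *\<^sub>R u n \<in> Z" "(\<lambda>n. c *\<^sub>R u n) \<longlonglongrightarrow> c *\<^sub>R x"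
      by (auto intro: subspace_scale[OF Z] tendsto_intros)
    then show ?thesis unfolding closure_sequential
      by (intro exI[of _ "\<lambda>n. c *\<^sub>R u n"]) simp
  qed
qed

text \<open>Rational combinations of the points of \<open>P\<close>, coded as lists of
  coefficient-point pairs, are dense in the span.\<close>

lemma span_separable:
  fixes P :: "'a::real_normed_vector set"
  assumes "countable P"
  obtains Q where "countable Q" "span P \<subseteq> closure Q"
proof -
  define comb where "comb = (\<lambda>l :: (real \<times> 'a) list. sum_list (map (\<lambda>(q, p). q *\<^sub>R p) l))"
  define Q where "Q = comb ` lists (\<rat> \<times> P)"
  have count: "countable Q"
    unfolding Q_def using assms countable_rat by (intro countable_image countable_lists) auto
  have Q_cons: "q *\<^sub>R p + y \<in> Q" if q: "q \<in> \<rat>" and p: "p \<in> P" and y: "y \<in> Q" for q p y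
  proof -
    obtain l where "l \<in> lists (\<rat> \<times> P)" "y = comb l" using y by (auto simp: Q_def)
    then have "q *\<^sub>R p + y = comb ((q, p) # l)" "(q, p) # l \<in> lists (\<rat> \<times> P)"
      using q p by (auto simp: comb_def)
    then show ?thesis unfolding Q_def by blast
  qed
  have "x \<in> closure Q" if "x \<in> span P" for x
    using that
  proof (induction rule: span_induct_alt)
    case base
    have "comb [] \<in> Q" unfolding Q_def by blast
    then show ?case using closure_subset by (auto simp: comb_def)
  next
    case (step c p y)
    show ?case unfolding closure_approachable
    proof (intro allI impI)
      fix e :: real assume e: "e > 0"
      obtain z where z: "z \<in> Q" "dist z y < e/2"
        using step e closure_approachable[of y Q] by (meson half_gt_zero)
      \<comment> \<open>The summand 1 keeps the denominator positive when \<open>p\<close> is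
        zero.\<close>
      have "e / (2 * (norm p + 1)) > 0" using e by (intro divide_pos_pos) (auto simp: add_nonneg_pos)
      then obtain q where q: "q \<in> \<rat>" "\<bar>q - c\<bar> < e / (2 * (norm p + 1))"
        using Rats_dense_in_real[of "c - e / (2 * (norm p + 1))" "c + e / (2 * (norm p + 1))"]
        by (auto simp: abs_less_iff)
      have "dist (q *\<^sub>R p + z) (c *\<^sub>R p + y) \<le> dist (q *\<^sub>R p) (c *\<^sub>R p) + dist z y"
        by (rule dist_triangle_add)
      also have "dist (q *\<^sub>R p) (c *\<^sub>R p) = \<bar>q - c\<bar> * norm p"
        by (simp add: dist_norm flip: scaleR_diff_left)
      also have "\<dots> \<le> \<bar>q - c\<bar> * (norm p + 1)" by (simp add: mult_left_mono)
      also have "\<dots> \<le> e/2"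
      proof -
        have "norm p + 1 > 0" by (simp add: add_nonneg_pos)
        then show ?thesis using q(2) by (simp add: field_simps)
      qed
      finally have "dist (q *\<^sub>R p + z) (c *\<^sub>R p + y) < e" using z(2) by simp
      then show "\<exists>w\<in>Q. dist w (c *\<^sub>R p + y) < e" using Q_cons q z step by blast
    qed
  qed
  with count show ?thesis using that by blast
qed

lemma uncountable_nat_bool: "\<not> countable (UNIV :: (nat \<Rightarrow> bool) set)"
proof
  assume "countable (UNIV :: (nat \<Rightarrow> bool) set)"
  then obtain f :: "nat \<Rightarrow> nat \<Rightarrow> bool" where f: "range f = UNIV"
    using uncountable_def by blast
  then obtain n where "f n = (\<lambda>k. \<not> f k k)" by (metis UNIV_I imageE)
  then show False by metis
qed

text \<open>These are the topologies at least as fine as the weak topology of the underlying real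
  space. The abstraction keeps the scalars of K out of the fragmentation and slicing
  arguments.\<close>

locale functional_topology =
  fixes T :: "'a::real_normed_vector topology"
  assumes topspace_UNIV: "topspace T = UNIV"
    and continuous_functional: "bounded_linear g \<Longrightarrow> continuous_map T euclideanreal g"
begin

lemma open_halfspace:
  fixes g :: "'a \<Rightarrow> real"
  shows "bounded_linear g \<Longrightarrow> openin T {x. g x > a}"
  "bounded_linear g \<Longrightarrow> openin T {x. g x < a}"
  using openin_continuous_map_preimage[OF continuous_functional, of g "{a<..}"]
    openin_continuous_map_preimage[OF continuous_functional, of g "{..<a}"]
  by (auto simp: topspace_UNIV)

lemma closed_halfspace:
  fixes g :: "'a \<Rightarrow> real"
  shows "bounded_linear g \<Longrightarrow> closedin T {x. g x \<ge> a}"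
  "bounded_linear g \<Longrightarrow> closedin T {x. g x \<le> a}"
  using closedin_continuous_map_preimage[OF continuous_functional, of g "{a..}"]
    closedin_continuous_map_preimage[OF continuous_functional, of g "{..a}"]
  by (auto simp: topspace_UNIV)

text \<open>A norm closed subspace is an intersection of kernels of functionals, so it is closed in
  \<open>T\<close> as well.\<close>

lemma closure_of_in_closed_span:
  assumes "y \<in> T closure_of S"
  shows "y \<in> closure (span S)"
proof (rule ccontr)
  assume "y \<notin> closure (span S)"
  then obtain g :: "'a \<Rightarrow> real" where g: "bounded_linear g" "\<And>z. z \<in> closure (span S) \<Longrightarrow> g z = 0" "g y > 0"
    using separating_functional[of "closure (span S)" y] by (metis closed_closure subspace_closure subspace_span)
  then obtain z where "z \<in> S" "g z > 0"
    using assms[unfolded in_closure_of, THEN conjunct2, rule_format, of "{x. g x > 0}"]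
      open_halfspace(1)[OF g(1), of 0] by auto
  moreover have "z \<in> closure (span S)"
    using span_base[OF \<open>z \<in> S\<close>] closure_subset[of "span S"] by (rule subsetD[rotated])
  ultimately show False using g(2) by force
qed

text \<open>A gap in the values of one functional of norm at most 1 persists under closure in
  \<open>T\<close>. A lower bound on the norm distances alone need not persist, since the norm is
  only lower semicontinuous.\<close>

definition separated :: "real \<Rightarrow> 'a set \<Rightarrow> 'a set \<Rightarrow> bool" where
  "separated e V W \<longleftrightarrow> (\<exists>g a b. bounded_linear g \<and> (\<forall>x. \<bar>g x\<bar> \<le> norm x) \<and> b - a \<ge> e \<and>
     V \<subseteq> {x. g x \<ge> b} \<and> W \<subseteq> {x. g x \<le> a})"

lemma separated_closure_of:
  assumes "separated e V W" "x \<in> T closure_of V" "y \<in> T closure_of W"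
  shows "norm (x - y) \<ge> e"
proof -
  obtain g a b where g: "bounded_linear g" "\<And>x. \<bar>g x\<bar> \<le> norm x" "b - a \<ge> e"
    "V \<subseteq> {x. g x \<ge> b}" "W \<subseteq> {x. g x \<le> a}"
    using assms(1) unfolding separated_def by blast
  have "g x \<ge> b"
    using closure_of_minimal[OF g(4) closed_halfspace(1)[OF g(1)]] assms(2) by blast
  moreover have "g y \<le> a"
    using closure_of_minimal[OF g(5) closed_halfspace(2)[OF g(1)]] assms(3) by blast
  moreover have "g (x - y) = g x - g y"
    using bounded_linear.linear[OF g(1)] by (rule linear_diff)
  ultimately show ?thesis using g(2)[of "x - y"] g(3) by linarith
qed

text \<open>If no piece were small, splitting repeatedly would give a binary tree of relatively open
  pieces. Cluster points along the branches are uniformly separated, uncountably many, and all lie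
  in the closed span of the countably many points chosen at the nodes.\<close>

theorem norm_fragmented:
  assumes D: "compactin T D" and U: "openin T U" "U \<inter> D \<noteq> {}" and e: "e > 0"
  obtains V where "openin T V" "V \<subseteq> U" "V \<inter> D \<noteq> {}"
    "\<And>x y. x \<in> V \<inter> D \<Longrightarrow> y \<in> V \<inter> D \<Longrightarrow> norm (x - y) \<le> e"
proof (rule ccontr)
  assume "\<not> thesis"
  note conclude = that
  have large: "\<exists>x\<in>V \<inter> D. \<exists>y\<in>V \<inter> D. norm (x - y) > e"
    if V: "openin T V" "V \<subseteq> U" "V \<inter> D \<noteq> {}" for V
    proof (rule ccontr)
    assume "\<not> ?thesis"
    then have "norm (x - y) \<le> e" if "x \<in> V \<inter> D" "y \<in> V \<inter> D" for x y
      using that by force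
    then show False using conclude[OF V] \<open>\<not> thesis\<close> by blast
  qed
  define good where "good V \<longleftrightarrow> openin T V \<and> V \<subseteq> U \<and> V \<inter> D \<noteq> {}" for V
  have "\<exists>V1 V2. good V1 \<and> good V2 \<and> V1 \<subseteq> V \<and> V2 \<subseteq> V \<and> separated (e/3) V1 V2" if V: "good V" for V
  proof -
    obtain x y where xy: "x \<in> V \<inter> D" "y \<in> V \<inter> D" "norm (x - y) > e"
      using large V unfolding good_def by meson
    obtain g where g: "bounded_linear g" "\<And>x. \<bar>g x\<bar> \<le> norm x" "g (x - y) = norm (x - y)"
      using norming_functional by blast
    have gxy: "g x - g y > e"
      using g(3) xy(3) linear_diff[OF bounded_linear.linear[OF g(1)], of x y] by simp
    \<comment> \<open>The functional differs by more than \<open>e\<close> at \<open>x\<close> and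
      \<open>y\<close>; giving up a third on each side makes both pieces open and leaves a gap of at
      least \<open>e/3\<close>.\<close>
    define V1 where "V1 = V \<inter> {z. g z > g x - e/3}"
    define V2 where "V2 = V \<inter> {z. g z < g y + e/3}"
    have "good V1" "good V2"
      using V xy e open_halfspace[OF g(1)] unfolding good_def V1_def V2_def
      by (auto intro!: openin_Int)
    moreover have "separated (e/3) V1 V2"
      unfolding separated_def
      by (rule exI[of _ g], rule exI[of _ "g y + e/3"], rule exI[of _ "g x - e/3"])
        (use g gxy in \<open>auto simp: V1_def V2_def\<close>)
    ultimately show ?thesis by (auto simp: V1_def V2_def)
  qed
  then obtain hi lo where hl: "\<And>V. good V \<Longrightarrow> good (hi V) \<and> good (lo V) \<and> hi V \<subseteq> V \<and> lo V \<subseteq> V \<and>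
      separated (e/3) (hi V) (lo V)"
    by metis
  define node where "node = rec_list U (\<lambda>b s V. if b then hi V else lo V)"
  have node: "node [] = U" "node (b # s) = (if b then hi (node s) else lo (node s))" for b s
    by (auto simp: node_def)
  have good_node: "good (node s)" for s
    by (induction s) (use U hl in \<open>auto simp: node good_def\<close>)
  have "\<exists>x. x \<in> node s \<inter> D" for s using good_node[of s] by (auto simp: good_def)
  then obtain pt where pt: "\<And>s. pt s \<in> node s \<inter> D" by metis
  \<comment> \<open>The newest choice stands at the head of the list, so the tail of a list is the
    parent node.\<close>
  define branch where "branch \<sigma> = rec_nat [] (\<lambda>n s. \<sigma> n # s)" for \<sigma> :: "nat \<Rightarrow> bool"
  have branch: "branch \<sigma> 0 = []" "branch \<sigma> (Suc n) = \<sigma> n # branch \<sigma> n" for \<sigma> n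
    by (auto simp: branch_def)
  have branch_cong: "branch \<sigma> n = branch \<tau> n" if "\<And>k. k < n \<Longrightarrow> \<sigma> k = \<tau> k" for \<sigma> \<tau> n
    using that by (induction n) (auto simp: branch)
  have node_mono: "node (branch \<sigma> m) \<subseteq> node (branch \<sigma> n)" if "n \<le> m" for \<sigma> m n
  proof (rule lift_Suc_antimono_le[OF _ that])
    show "node (branch \<sigma> (Suc k)) \<subseteq> node (branch \<sigma> k)" for k
      using hl[OF good_node[of "branch \<sigma> k"]] by (simp add: branch node)
  qed
  define tail where "tail \<sigma> n = (\<lambda>m. pt (branch \<sigma> m)) ` {n..}" for \<sigma> n
  have tail_node: "tail \<sigma> n \<subseteq> node (branch \<sigma> n)" for \<sigma> n
    using pt node_mono unfolding tail_def by blast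
  \<comment> \<open>A cluster point of the chosen points along the branch, from the finite
    intersection property in \<open>D\<close>.\<close>
  have "\<exists>y\<in>D. \<forall>n. y \<in> T closure_of tail \<sigma> n" for \<sigma>
  proof -
    have "D \<inter> \<Inter>\<F> \<noteq> {}" if \<F>: "finite \<F>" "\<F> \<subseteq> range (\<lambda>n. T closure_of tail \<sigma> n)" for \<F>
    proof -
      obtain N where N: "finite N" "\<F> = (\<lambda>n. T closure_of tail \<sigma> n) ` N"
        using finite_subset_image[OF \<F>] by blast
      define m where "m = Max N"
      have m: "n \<le> m" if "n \<in> N" for n
        unfolding m_def using N(1) that by simp
      have "pt (branch \<sigma> m) \<in> T closure_of tail \<sigma> n" if "n \<in> N" for n
        using m[OF that] closure_of_subset[of "tail \<sigma> n" T]
        by (auto simp: tail_def topspace_UNIV)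
      then have "pt (branch \<sigma> m) \<in> \<Inter>\<F>" unfolding N(2) by blast
      then show ?thesis using pt by blast
    qed
    moreover have "closedin T C" if "C \<in> range (\<lambda>n. T closure_of tail \<sigma> n)" for C
      using that by auto
    ultimately have "D \<inter> \<Inter>(range (\<lambda>n. T closure_of tail \<sigma> n)) \<noteq> {}"
      using D[unfolded compactin_fip, THEN conjunct2, rule_format] by (metis (no_types, lifting))
    then show ?thesis by blast
  qed
  then have "\<exists>y. \<forall>n. y \<in> T closure_of tail \<sigma> n" for \<sigma> by blast
  then obtain lim where lim: "\<And>\<sigma> n. lim \<sigma> \<in> T closure_of tail \<sigma> n" by metis
  \<comment> \<open>At the first disagreement the two branches enter \<open>hi\<close> and
    \<open>lo\<close> of the same node. Their later points stay there, so the cluster points inherit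
    the gap.\<close>
  have sep1: "norm (lim \<sigma> - lim \<tau>) \<ge> e/3"
    if "branch \<sigma> n = branch \<tau> n" "\<sigma> n" "\<not> \<tau> n" for \<sigma> \<tau> n
  proof (rule separated_closure_of)
    show "separated (e/3) (hi (node (branch \<sigma> n))) (lo (node (branch \<sigma> n)))"
      using hl good_node by blast
    have tails: "tail \<sigma> (Suc n) \<subseteq> hi (node (branch \<sigma> n))" "tail \<tau> (Suc n) \<subseteq> lo (node (branch \<sigma> n))"
      using tail_node[of \<sigma> "Suc n"] tail_node[of \<tau> "Suc n"] that by (auto simp: branch node)
    show "lim \<sigma> \<in> T closure_of hi (node (branch \<sigma> n))"
      using closure_of_mono[OF tails(1), of T] lim[of \<sigma> "Suc n"] by (rule subsetD)
    show "lim \<tau> \<in> T closure_of lo (node (branch \<sigma> n))"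
      using closure_of_mono[OF tails(2), of T] lim[of \<tau> "Suc n"] by (rule subsetD)
  qed
  have sep: "norm (lim \<sigma> - lim \<tau>) \<ge> e/3" if ne: "\<sigma> \<noteq> \<tau>" for \<sigma> \<tau>
  proof -
    define n where "n = (LEAST n. \<sigma> n \<noteq> \<tau> n)"
    obtain k where "\<sigma> k \<noteq> \<tau> k" using ne by (auto simp: fun_eq_iff)
    then have n: "\<sigma> n \<noteq> \<tau> n" unfolding n_def by (rule LeastI)
    have "\<sigma> i = \<tau> i" if "i < n" for i
      using not_less_Least[of i "\<lambda>n. \<sigma> n \<noteq> \<tau> n"] that by (simp add: n_def)
    then have eq: "branch \<sigma> n = branch \<tau> n" by (rule branch_cong)
    show ?thesis
    proof (cases "\<sigma> n")
      case True
      then show ?thesis using sep1[OF eq] n by simp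
    next
      case False
      then show ?thesis using sep1[OF eq[symmetric]] n by (simp add: norm_minus_commute)
    qed
  qed
  obtain Q where Q: "countable Q" "span (range pt) \<subseteq> closure Q"
    using span_separable[of "range pt"] by auto
  have lim_closure: "lim \<sigma> \<in> closure Q" for \<sigma>
  proof -
    have "tail \<sigma> 0 \<subseteq> range pt" by (auto simp: tail_def)
    from closure_of_mono[OF this, of T] lim[of \<sigma> 0] have "lim \<sigma> \<in> T closure_of range pt"
      by (rule subsetD)
    then have "lim \<sigma> \<in> closure (span (range pt))" by (rule closure_of_in_closed_span)
    then show ?thesis using Q(2) closure_mono[OF Q(2)] by auto
  qed
  \<comment> \<open>Half of the separation \<open>e/3\<close>: two limits sharing an approximant
    would be too close to each other.\<close>
  have "\<exists>q\<in>Q. dist q (lim \<sigma>) < e/6" for \<sigma>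
    using lim_closure[of \<sigma>, unfolded closure_approachable, rule_format, of "e/6"] e by simp
  then obtain q where q: "\<And>\<sigma>. q \<sigma> \<in> Q" "\<And>\<sigma>. dist (q \<sigma>) (lim \<sigma>) < e/6" by metis
  have "inj q"
  proof (rule injI, rule ccontr)
    fix \<sigma> \<tau> assume *: "q \<sigma> = q \<tau>" "\<sigma> \<noteq> \<tau>"
    have "dist (lim \<sigma>) (lim \<tau>) < e/6 + e/6"
      using q(2)[of \<sigma>] q(2)[of \<tau>] *(1) dist_triangle3[of "lim \<sigma>" "lim \<tau>" "q \<sigma>"] by simp
    then show False using sep[OF *(2)] by (simp add: dist_norm)
  qed
  moreover have "countable (range q)" using Q(1) q(1) by (intro countable_subset[OF _ Q(1)]) auto
  ultimately show False
    using countable_image_inj_on[of q UNIV] uncountable_nat_bool by simp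
qed

subsection \<open>Small slices of weakly compact sets\<close>

lemma functional_attains_max:
  fixes g :: "'a \<Rightarrow> real"
  assumes "compactin T C" "C \<noteq> {}" "bounded_linear g"
  obtains c where "c \<in> C" "\<And>y. y \<in> C \<Longrightarrow> g y \<le> g c"
proof -
  have "compact (g ` C)"
    using image_compactin[OF assms(1) continuous_functional[OF assms(3)]] by simp
  then obtain s where "s \<in> g ` C" "\<forall>t\<in>g ` C. t \<le> s"
    using compact_attains_sup[of "g ` C"] assms(2) by blast
  then show ?thesis using that by blast
qed

text \<open>For \<open>D\<close> compact in \<open>T\<close> this says that \<open>A\<close> lies in
  the closed convex hull of \<open>D\<close>, expressed through functionals so that no convex hull
  has to be formed.\<close>

definition dominated :: "'a set \<Rightarrow> 'a set \<Rightarrow> bool" where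
  "dominated A D \<longleftrightarrow> (\<forall>g :: 'a \<Rightarrow> real. bounded_linear g \<longrightarrow> (\<forall>y\<in>A. \<exists>d\<in>D. g y \<le> g d))"

text \<open>Zorn is applied to the open sets removed from \<open>A\<close>, ordered by inclusion, so
  a chain is bounded by its union. Domination survives the union by compactness.\<close>

lemma minimal_dominating:
  assumes A: "compactin T A"
  obtains U where "openin T U" "dominated A (A - U)"
    "\<And>V. openin T V \<Longrightarrow> U \<subseteq> V \<Longrightarrow> dominated A (A - V) \<Longrightarrow> V = U"
proof -
  define F where "F = {U. openin T U \<and> dominated A (A - U)}"
  have "\<exists>M\<in>F. \<forall>X\<in>F. M \<subseteq> X \<longrightarrow> X = M"
  proof (rule subset_Zorn_nonempty)
    have "{} \<in> F" by (auto simp: F_def dominated_def)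
    then show "F \<noteq> {}" by blast
  next
    fix C assume C: "C \<noteq> {}" "subset.chain F C"
    then have CF: "\<And>U. U \<in> C \<Longrightarrow> openin T U \<and> dominated A (A - U)"
      by (auto simp: F_def subset_chain_def)
    have "dominated A (A - \<Union>C)"
      unfolding dominated_def
    proof (intro allI impI ballI)
      fix g :: "'a \<Rightarrow> real" and y assume g: "bounded_linear g" and y: "y \<in> A"
      show "\<exists>d\<in>A - \<Union>C. g y \<le> g d"
      proof (rule ccontr)
        assume "\<not> ?thesis"
        \<comment> \<open>A failure for the union puts a compact slice inside it. Finitely many
          chain members then cover the slice, hence so does the largest of them, which contradicts
          domination for that member.\<close>
        then have "A \<inter> {x. g x \<ge> g y} \<subseteq> \<Union>C" by blast
        moreover have "compactin T (A \<inter> {x. g x \<ge> g y})"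
          using compact_Int_closedin[OF A closed_halfspace(1)[OF g]] .
        ultimately obtain G where G: "finite G" "G \<subseteq> C" "A \<inter> {x. g x \<ge> g y} \<subseteq> \<Union>G"
          using CF unfolding compactin_def by metis
        have "G \<noteq> {}" using G(3) y by auto
        moreover have "subset.chain F G" using C(2) G(2) unfolding subset_chain_def by (meson order_trans subsetD)
        ultimately have "\<Union>G \<in> G" using Union_in_chain[OF G(1)] by blast
        then obtain d where "d \<in> A - \<Union>G" "g y \<le> g d"
          using CF[of "\<Union>G"] G(2) g y unfolding dominated_def by blast
        then show False using G(3) by blast
      qed
    qed
    then show "\<Union>C \<in> F" using CF by (auto simp: F_def)
  qed
  then obtain U where "U \<in> F" "\<And>X. X \<in> F \<Longrightarrow> U \<subseteq> X \<Longrightarrow> X = U" by blast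
  then show ?thesis using that[of U] by (simp add: F_def)
qed

text \<open>Let \<open>D\<close> be a minimal closed subset of \<open>A\<close> on which every functional has the same maximum as
  on \<open>A\<close>, and let \<open>V \<inter> D\<close> be a small piece of it. By minimality some \<open>f\<close> is smaller on
  \<open>D - V\<close> than its maximum. Applying the domination to \<open>g + c f\<close> for \<open>c\<close> large then shows
  that the slices of the whole set \<open>A\<close> by \<open>f\<close> are small as well. This replaces the passage
  through extreme points of the closed convex hull.\<close>

theorem small_slice:
  assumes A: "compactin T A" "A \<subseteq> cball 0 1" and a: "a \<in> A" "norm a > r" and e: "e > 0"
  obtains f :: "'a \<Rightarrow> real" and d \<alpha> where "bounded_linear f" "d \<in> A" "norm d > r"
    "\<exists>y\<in>A. f y > \<alpha>" "\<And>y. y \<in> A \<Longrightarrow> f y > \<alpha> \<Longrightarrow> norm (y - d) \<le> e"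
proof -
  obtain U where U: "openin T U" "dominated A (A - U)"
    "\<And>V. openin T V \<Longrightarrow> U \<subseteq> V \<Longrightarrow> dominated A (A - V) \<Longrightarrow> V = U"
    using minimal_dominating[OF A(1)] by blast
  have compact_diff: "compactin T (A - W)" if "openin T W" for W
  proof -
    have "A - W = A \<inter> (topspace T - W)" by (auto simp: topspace_UNIV)
    then show ?thesis using compact_Int_closedin[OF A(1)] that by (metis openin_closedin_eq)
  qed
  define D where "D = A - U"
  \<comment> \<open>Domination for the norming functional of \<open>a\<close> gives a point of
    \<open>D\<close> with \<open>g0\<close> above \<open>r\<close>. Choosing the small piece inside
    this half-space makes its points have norm above \<open>r\<close>.\<close>
  obtain g0 where g0: "bounded_linear g0" "\<And>x. \<bar>g0 x\<bar> \<le> norm x" "g0 a = norm a"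
    using norming_functional by blast
  obtain d0 where d0: "d0 \<in> D" "g0 a \<le> g0 d0"
    using U(2) g0(1) a(1) unfolding dominated_def D_def by blast
  have "g0 d0 > r" using d0 g0(3) a(2) by linarith
  then have ne: "{x. g0 x > r} \<inter> D \<noteq> {}" using d0(1) by blast
  have D: "compactin T D" using compact_diff[OF U(1)] by (simp add: D_def)
  have "e/2 > 0" using e by simp
  with norm_fragmented[OF D open_halfspace(1)[OF g0(1)] ne]
  obtain V where V: "openin T V" "V \<subseteq> {x. g0 x > r}" "V \<inter> D \<noteq> {}"
    "\<And>x y. x \<in> V \<inter> D \<Longrightarrow> y \<in> V \<inter> D \<Longrightarrow> norm (x - y) \<le> e/2"
    by (metis (no_types, lifting))
  obtain d where d: "d \<in> V" "d \<in> D" using V(3) by blast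
  have dA: "d \<in> A" using d(2) by (simp add: D_def)
  have "norm d > r" using V(2) d(1) g0(2)[of d] by force
  have "U \<union> V \<noteq> U" using d by (auto simp: D_def)
  then have "\<not> dominated A (A - (U \<union> V))"
    using U(3)[of "U \<union> V"] U(1) V(1) by blast
  then obtain f :: "'a \<Rightarrow> real" and y1
    where f: "bounded_linear f" and y1: "y1 \<in> A" "\<And>x. x \<in> A - (U \<union> V) \<Longrightarrow> f x < f y1"
    unfolding dominated_def not_all not_imp bex_simps not_le by (auto simp: not_le)
  \<comment> \<open>The strict inequalities below \<open>f y1\<close> become a uniform gap, because
    \<open>f\<close> attains its maximum on the compact remainder if that is nonempty.\<close>
  obtain \<beta> where \<beta>: "\<beta> < f y1" "\<And>x. x \<in> A - (U \<union> V) \<Longrightarrow> f x \<le> \<beta>"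
  proof (cases "A - (U \<union> V) = {}")
    case True
    then show ?thesis by (intro that[of "f y1 - 1"]) auto
  next
    case False
    have "compactin T (A - (U \<union> V))" using compact_diff U(1) V(1) by blast
    then obtain c where "c \<in> A - (U \<union> V)" "\<And>x. x \<in> A - (U \<union> V) \<Longrightarrow> f x \<le> f c"
      using functional_attains_max[OF _ False f] by blast
    then show ?thesis using y1 by (intro that[of "f c"])
  qed
  obtain y0 where y0: "y0 \<in> A" "\<And>y. y \<in> A \<Longrightarrow> f y \<le> f y0"
    using functional_attains_max[OF A(1) _ f] a(1) by blast
  define \<eta> where "\<eta> = f y0 - \<beta>"
  have \<eta>: "\<eta> > 0" using y0(2)[OF y1(1)] \<beta>(1) by (simp add: \<eta>_def)
  \<comment> \<open>Outside \<open>V\<close> the term \<open>c * f\<close> loses at least 2 against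
    its maximum, which compensates the largest possible variation of \<open>g\<close> on the unit
    ball.\<close>
  define c where "c = 2 / \<eta>"
  have c: "c > 0" "c * \<eta> = 2" using \<eta> by (auto simp: c_def)
  \<comment> \<open>On the slice \<open>c * f\<close> stays within \<open>e/2\<close> of its
    maximum; the diameter of \<open>V \<inter> D\<close> accounts for the other
    \<open>e/2\<close>.\<close>
  define \<alpha> where "\<alpha> = f y0 - e / (2 * c)"
  have "norm (y - d) \<le> e" if y: "y \<in> A" "f y > \<alpha>" for y
  proof -
    \<comment> \<open>The functional \<open>g\<close> depends on \<open>y\<close>, whereas
      \<open>c\<close> and \<open>\<alpha>\<close> do not; hence one slice works for all
      \<open>y\<close>.\<close>
    obtain g where g: "bounded_linear g" "\<And>x. \<bar>g x\<bar> \<le> norm x" "g (y - d) = norm (y - d)"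
      using norming_functional by blast
    have lin: "g (u - v) = g u - g v" for u v
      using linear_diff[OF bounded_linear.linear[OF g(1)]] .
    have "bounded_linear (\<lambda>x. g x + c * f x)"
      using g(1) f by (intro bounded_linear_add bounded_linear_const_mult)
    then obtain d' where d': "d' \<in> A - U" "g y + c * f y \<le> g d' + c * f d'"
      using U(2) y(1) unfolding dominated_def by blast
    have "g d' + c * f d' \<le> g d + e/2 + c * f y0"
    proof (cases "d' \<in> V")
      case True
      have "g d' - g d \<le> norm (d' - d)" using g(2)[of "d' - d"] lin[of d' d] by simp
      also have "\<dots> \<le> e/2" using V(4) True d d' by (auto simp: D_def)
      finally have "g d' \<le> g d + e/2" by simp
      moreover have "c * f d' \<le> c * f y0" using y0(2) d' c by simp
      ultimately show ?thesis by simp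
    next
      case False
      have "f d' \<le> \<beta>" using \<beta>(2) d' False by blast
      then have "c * f d' \<le> c * \<beta>" using c by simp
      also have "c * \<beta> = c * f y0 - 2" using c(2) by (simp add: \<eta>_def algebra_simps)
      finally have "c * f d' \<le> c * f y0 - 2" .
      moreover have "norm d' \<le> 1" "norm d \<le> 1" using A(2) d' dA by auto
      then have "g d' \<le> 1" "g d \<ge> -1" using g(2)[of d'] g(2)[of d] by linarith+
      ultimately show ?thesis using e by simp
    qed
    moreover have "c * f y \<ge> c * f y0 - e/2"
    proof -
      have "c * \<alpha> \<le> c * f y" using y(2) c(1) by simp
      then show ?thesis using c(1) by (simp add: \<alpha>_def right_diff_distrib)
    qed
    ultimately have "g y - g d \<le> e" using d'(2) by linarith
    then show ?thesis using g(3) lin by simp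
  qed
  moreover have "\<exists>y\<in>A. f y > \<alpha>"
    using y0(1) e c(1) by (auto simp: \<alpha>_def intro!: bexI[of _ y0])
  ultimately show ?thesis using that f dA \<open>norm d > r\<close> by blast
qed

end

subsection \<open>Scalars and functionals over K\<close>

text \<open>The class provides a ring embedding that preserves the norm; the added information is
  that it fixes the real scalars.\<close>

lemma K_embedding:
  obtains h :: "'k::real_or_complex \<Rightarrow> complex"
  where "\<And>x y. h (x + y) = h x + h y" "\<And>x y. h (x * y) = h x * h y"
    "\<And>x. norm (h x) = norm x" "\<And>r. h (of_real r) = of_real r" "range h = \<real> \<or> range h = UNIV"
proof -
  obtain h :: "'k \<Rightarrow> complex" where h: "\<And>x y. h (x + y) = h x + h y" "\<And>x y. h (x * y) = h x * h y"
    "\<And>x. norm (h x) = norm x" "range h = \<real> \<or> range h = UNIV"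
    using real_or_complex by blast
  have one: "h 1 = 1"
    using h(2)[of 1 1] h(3)[of 1] by auto
  have "h (of_real r) = of_real r" for r
  proof -
    \<comment> \<open>\<open>z\<close> lies on the circle about 0 of radius
      \<open>\<bar>r\<bar>\<close> and on the circle about 1 of radius
      \<open>\<bar>r - 1\<bar>\<close>; these meet only at \<open>r\<close>.\<close>
    define z where "z = h (of_real r)"
    have 1: "(Re z)\<^sup>2 + (Im z)\<^sup>2 = r\<^sup>2"
      using h(3)[of "of_real r"] cmod_power2[of z] by (simp add: z_def)
    have "z = h (of_real (r - 1)) + 1"
      using h(1)[of "of_real (r - 1)" 1] one by (simp add: z_def)
    then have "cmod (z - 1) = \<bar>r - 1\<bar>"
      using h(3)[of "of_real (r - 1)"] norm_of_real[of "r - 1", where 'a='k] by (simp del: of_real_diff)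
    then have 2: "(Re z - 1)\<^sup>2 + (Im z)\<^sup>2 = (r - 1)\<^sup>2"
      using cmod_power2[of "z - 1"] by simp
    have "Re z = r" using 1 2 by (simp add: power2_eq_square algebra_simps)
    moreover from this have "Im z = 0" using 1 by simp
    ultimately show ?thesis by (simp add: z_def complex_eq_iff)
  qed
  with h show ?thesis using that by blast
qed

text \<open>The isometric embedding has closed range, and its inverse carries the compact part of
  the complex circle in that range back to K.\<close>

lemma compact_unit_circle: "compact (sphere 0 1 :: 'k::real_or_complex set)"
proof -
  obtain h :: "'k \<Rightarrow> complex" where h: "\<And>x y. h (x + y) = h x + h y"
    "\<And>x. norm (h x) = norm x" "range h = \<real> \<or> range h = UNIV"
    using K_embedding by metis
  have diff: "h (x - y) = h x - h y" for x y
    using h(1)[of "x - y" y] by simp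
  have dist: "dist (h x) (h y) = dist x y" for x y
    using h(2)[of "x - y"] by (simp add: dist_norm diff)
  have inj: "inj h"
    by (rule injI) (use dist in \<open>metis dist_eq_0_iff\<close>)
  have "closed (range h)" using h(3) closed_complex_Reals by auto
  then have "compact (range h \<inter> sphere 0 1)" by (intro closed_Int_compact) auto
  moreover have "continuous_on (range h \<inter> sphere 0 1) (inv h)"
  proof (rule continuous_on_subset)
    show "continuous_on (range h) (inv h)"
      unfolding continuous_on_iff using dist inj by (auto simp: inv_f_f)
  qed simp
  ultimately have "compact (inv h ` (range h \<inter> sphere 0 1))" by (rule compact_continuous_image[rotated])
  also have "inv h ` (range h \<inter> sphere 0 1) = sphere 0 1"
    using inj h(2) by (force simp: inv_f_f image_iff)
  finally show ?thesis .
qed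

lemma vector_space_self: "vector_space ((*) :: 'k::field \<Rightarrow> 'k \<Rightarrow> 'k)"
  by unfold_locales (auto simp: algebra_simps)

lemma unimodular_rotation:
  fixes c :: "'k::real_normed_field"
  obtains \<eta> where "norm \<eta> = 1" "\<eta> * c = of_real (norm c)"
proof (cases "c = 0")
  case True
  then show ?thesis using that[of 1] by simp
next
  case False
  then show ?thesis using that[of "of_real (norm c) / c"] by (simp add: norm_divide)
qed

context K_banach
begin

lemma dual_spaceD:
  assumes "F \<in> dual_space smul"
  shows "F (x + y) = F x + F y" "F (smul c x) = c * F x" "\<exists>C. \<forall>v. norm (F v) \<le> C * norm v"
  using assms unfolding dual_space_def Vector_Spaces.linear_iff by auto

lemma scaleR_scale: "smul (r *\<^sub>R c) v = r *\<^sub>R smul c v"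
  by (simp add: scaleR_conv_of_real flip: scale_of_real)

lemma scale_scaleR: "smul c (r *\<^sub>R v) = r *\<^sub>R smul c v"
  by (simp add: mult.commute flip: scale_of_real)

lemma bounded_linear_scale: "bounded_linear (smul c)"
  by (rule bounded_linear_intro[where K = "norm c"])
    (auto simp: scale_right_distrib scale_scaleR norm_scale mult.commute)

text \<open>Here \<open>\<rho>\<close> is the real part. Exporting only its properties lets the
  later proofs treat the real and complex cases at once.\<close>

lemma real_functional_dual:
  fixes g :: "'v \<Rightarrow> real"
  assumes g: "bounded_linear g"
  obtains F and \<rho> :: "'k \<Rightarrow> real" where "F \<in> dual_space smul" "\<And>y. \<rho> (F y) = g y"
    "continuous_on UNIV \<rho>" "\<And>c. \<rho> c \<le> norm c" "\<And>r. \<rho> (of_real r) = r"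
proof -
  obtain h :: "'k \<Rightarrow> complex" where h: "\<And>x y. h (x + y) = h x + h y" "\<And>x y. h (x * y) = h x * h y"
    "\<And>x. norm (h x) = norm x" "\<And>r. h (of_real r) = of_real r" "range h = \<real> \<or> range h = UNIV"
    using K_embedding by metis
  have diff: "h (x - y) = h x - h y" for x y
    using h(1)[of "x - y" y] by simp
  have inj: "x = y" if "h x = h y" for x y
    using h(3)[of "x - y"] that by (simp add: diff)
  have h_dist: "dist (h x) (h y) = dist x y" for x y
    using h(3)[of "x - y"] by (simp add: dist_norm diff)
  define \<rho> where "\<rho> = (\<lambda>c. Re (h c))"
  have "continuous_on UNIV h"
    unfolding continuous_on_iff using h_dist by auto
  then have \<rho>: "continuous_on UNIV \<rho>" "\<rho> c \<le> norm c" "\<rho> (of_real r) = r" for c r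
    using complex_Re_le_cmod[of "h c"] h(3,4) by (auto simp: \<rho>_def intro: continuous_intros)
  have g_add: "g (x + y) = g x + g y" and g_scale: "g (r *\<^sub>R x) = r * g x" for x y r
    using g by (simp_all add: linear_simps)
  obtain K where K: "\<And>x. norm (g x) \<le> norm x * K" using bounded_linear.bounded[OF g] by blast
  show ?thesis
  proof (cases "range h = \<real>")
    case True
    define F where "F = (\<lambda>y. of_real (g y) :: 'k)"
    have c: "c = of_real (\<rho> c)" for c
    proof (rule inj)
      have "h c \<in> \<real>" using True by blast
      then show "h c = h (of_real (\<rho> c))" using h(4) by (auto simp: \<rho>_def complex_is_Real_iff complex_eq_iff)
    qed
    have "F (smul c y) = c * F y" for c y
      by (subst (1 2) c) (simp add: F_def scale_of_real g_scale)
    then have "F \<in> dual_space smul"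
      unfolding dual_space_def Vector_Spaces.linear_iff
      using vector_space_axioms vector_space_self K
      by (auto simp: F_def g_add mult.commute intro!: exI[of _ K])
    then show ?thesis using \<rho> by (intro that[of F \<rho>]) (auto simp: F_def)
  next
    case False
    then obtain \<iota> where \<iota>: "h \<iota> = \<i>" using h(5) by (metis UNIV_I imageE)
    have \<iota>2: "\<iota> * \<iota> = -1"
      by (rule inj) (use h(2)[of \<iota> \<iota>] h(4)[of "-1"] \<iota> in simp)
    have \<iota>_norm: "norm \<iota> = 1" using h(3)[of \<iota>] \<iota> by simp
    \<comment> \<open>The usual complexification g(y) - i g(iy), the only complex linear functional
      with real part \<open>g\<close>.\<close>
    define F where "F = (\<lambda>y. of_real (g y) - \<iota> * of_real (g (smul \<iota> y)))"
    have c: "c = of_real (Re (h c)) + of_real (Im (h c)) * \<iota>" for c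
      by (rule inj) (simp add: h(1,2,4) \<iota> complex_eq_iff)
    have F_scale: "F (smul c y) = c * F y" for c y
    proof -
      define a b where "a = Re (h c)" and "b = Im (h c)"
      have c': "c = of_real a + of_real b * \<iota>" using c[of c] by (simp add: a_def b_def)
      have 1: "smul c y = a *\<^sub>R y + b *\<^sub>R smul \<iota> y"
        unfolding c' by (simp add: scale_left_distrib scale_of_real flip: scale_scale)
      have "smul \<iota> (smul c y) = a *\<^sub>R smul \<iota> y + b *\<^sub>R smul (\<iota> * \<iota>) y"
        unfolding 1 by (simp add: scale_right_distrib scale_scaleR)
      then have 2: "smul \<iota> (smul c y) = a *\<^sub>R smul \<iota> y - b *\<^sub>R y" by (simp add: \<iota>2)
      have "F (smul c y) = of_real (a * g y + b * g (smul \<iota> y)) - \<iota> * of_real (a * g (smul \<iota> y) - b * g y)"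
        unfolding F_def 2 unfolding 1 using g by (simp add: linear_simps)
      also have "\<dots> = of_real a * of_real (g y) + of_real b * of_real (g (smul \<iota> y))
          - of_real a * (\<iota> * of_real (g (smul \<iota> y))) + of_real b * \<iota> * of_real (g y)"
        by (simp add: algebra_simps)
      also have "\<dots> = (of_real a + of_real b * \<iota>) * of_real (g y)
          - of_real a * \<iota> * of_real (g (smul \<iota> y)) - of_real b * (\<iota> * \<iota>) * of_real (g (smul \<iota> y))"
        unfolding \<iota>2 by (simp add: algebra_simps)
      also have "\<dots> = c * F y" unfolding F_def c' by (simp add: algebra_simps)
      finally show ?thesis .
    qed
    have "norm (F y) \<le> (2 * K) * norm y" for y
    proof -
      have "norm (F y) \<le> \<bar>g y\<bar> + \<bar>g (smul \<iota> y)\<bar>"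
        unfolding F_def by (rule norm_triangle_le_diff) (simp add: norm_mult \<iota>_norm)
      also have "\<dots> \<le> (2 * K) * norm y"
        using K[of y] K[of "smul \<iota> y"] by (simp add: norm_scale \<iota>_norm algebra_simps)
      finally show ?thesis .
    qed
    moreover have "F (x + y) = F x + F y" for x y
      by (simp add: F_def scale_right_distrib g_add algebra_simps)
    ultimately have "F \<in> dual_space smul"
      unfolding dual_space_def Vector_Spaces.linear_iff
      using vector_space_axioms vector_space_self F_scale by blast
    moreover have "\<rho> (F y) = g y" for y
      by (simp add: F_def \<rho>_def diff h(2,4) \<iota>)
    ultimately show ?thesis using \<rho> that by blast
  qed
qed

section \<open>The weak topology over K\<close>

lemma openin_weak_vimage:
  assumes "F \<in> dual_space smul" "open U"
  shows "openin (weak_topology smul) (F -` U)"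
  unfolding weak_topology_def using assms by (intro topology_generated_by_Basis) blast

lemma topspace_weak: "topspace (weak_topology smul) = UNIV"
proof -
  obtain F where F: "F \<in> dual_space smul"
    by (rule real_functional_dual[OF bounded_linear_zero])
  have "F -` UNIV \<subseteq> topspace (weak_topology smul)"
    by (intro openin_subset openin_weak_vimage F) simp
  then show ?thesis by auto
qed

lemma dual_continuous_weak:
  assumes "F \<in> dual_space smul"
  shows "continuous_map (weak_topology smul) euclidean F"
  using openin_weak_vimage[OF assms]
  by (auto simp: continuous_map_def topspace_weak vimage_def)

sublocale weak: functional_topology "weak_topology smul"
proof
  show "topspace (weak_topology smul) = UNIV" by (rule topspace_weak)
  fix g :: "'v \<Rightarrow> real" assume "bounded_linear g"
  then obtain F and \<rho> :: "'k \<Rightarrow> real" where F: "F \<in> dual_space smul" "\<And>y. \<rho> (F y) = g y"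
    "continuous_on UNIV \<rho>"
    using real_functional_dual by metis
  have "continuous_map (weak_topology smul) euclideanreal (\<rho> \<circ> F)"
    using dual_continuous_weak[OF F(1)] F(3) by (intro continuous_map_compose[of _ euclidean]) auto
  moreover have "\<rho> \<circ> F = g" using F(2) by auto
  ultimately show "continuous_map (weak_topology smul) euclideanreal g" by simp
qed

text \<open>\<open>F (smul c y) = c * F y\<close> reduces joint continuity to that of multiplication
  in K. It makes the circled set, an image of circle times weak closure, weakly compact.\<close>

lemma scale_continuous_weak:
  "continuous_map (prod_topology euclidean (weak_topology smul)) (weak_topology smul) (\<lambda>(c, y). smul c y)"
  (is "continuous_map ?P _ ?s")
proof -
  have "openin ?P (?s -` (F -` U) \<inter> topspace ?P)" if F: "F \<in> dual_space smul" and U: "open U" for F U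
  proof -
    have "continuous_map ?P (prod_topology euclidean euclidean) (\<lambda>p. (fst p, F (snd p)))"
      using continuous_map_compose[OF continuous_map_snd dual_continuous_weak[OF F], of euclidean]
      by (intro continuous_map_pairedI) (auto simp: continuous_map_fst o_def)
    moreover have "continuous_map (prod_topology euclidean euclidean) euclidean (\<lambda>p :: 'k \<times> 'k. fst p * snd p)"
      by (simp add: continuous_intros)
    ultimately have "continuous_map ?P euclidean ((\<lambda>p. fst p * snd p) \<circ> (\<lambda>p. (fst p, F (snd p))))"
      by (rule continuous_map_compose)
    then have "openin ?P {p \<in> topspace ?P. ((\<lambda>p. fst p * snd p) \<circ> (\<lambda>p. (fst p, F (snd p)))) p \<in> U}"
      by (rule openin_continuous_map_preimage) (use U in simp)
    moreover have "{p \<in> topspace ?P. ((\<lambda>p. fst p * snd p) \<circ> (\<lambda>p. (fst p, F (snd p)))) p \<in> U}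
        = ?s -` (F -` U) \<inter> topspace ?P"
      by (auto simp: dual_spaceD(2)[OF F])
    ultimately show ?thesis by simp
  qed
  moreover have "\<Union>{f -` U |f U. f \<in> dual_space smul \<and> open U} = UNIV"
    using weak.topspace_UNIV unfolding weak_topology_def topology_generated_by_topspace .
  ultimately show ?thesis
    unfolding weak_topology_def[of smul]
    by (intro continuous_on_generated_topo) (auto simp: weak_topology_def)
qed

end

subsection \<open>Slices of weakly compact maps\<close>

lemma linftyI: "(\<And>x. x \<in> cball 0 1 \<Longrightarrow> norm (F x) \<le> m) \<Longrightarrow> F \<in> linfty"
  unfolding linfty_def bounded_iff by blast

lemma norm_le_linfty_norm:
  assumes "F \<in> linfty" "x \<in> cball 0 1"
  shows "norm (F x) \<le> linfty_norm F"
proof -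
  obtain m where "\<And>x. x \<in> cball 0 1 \<Longrightarrow> norm (F x) \<le> m"
    using assms(1) unfolding linfty_def bounded_iff by blast
  then have "bdd_above ((\<lambda>x. norm (F x)) ` cball 0 1)" by (rule bdd_aboveI2)
  then show ?thesis unfolding linfty_norm_def by (rule cSUP_upper[OF assms(2)])
qed

lemma linfty_norm_le: "(\<And>x. x \<in> cball 0 1 \<Longrightarrow> norm (F x) \<le> m) \<Longrightarrow> linfty_norm F \<le> m"
  unfolding linfty_norm_def by (rule cSUP_least) auto

lemma linfty_norm_gt:
  assumes "m < linfty_norm F"
  obtains x where "x \<in> cball 0 1" "m < norm (F x)"
  using assms linfty_norm_le[of F m] by (meson not_le)

context K_banach
begin

lemma linfty_dual:
  assumes "ys \<in> dual_space smul" "\<Psi> \<in> linfty"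
  shows "ys \<circ> \<Psi> \<in> linfty"
proof -
  obtain C where C: "\<And>v. norm (ys v) \<le> C * norm v" using dual_spaceD(3)[OF assms(1)] by blast
  obtain B where B: "\<And>x. x \<in> cball 0 1 \<Longrightarrow> norm (\<Psi> x) \<le> B"
    using norm_le_linfty_norm[OF assms(2)] by blast
  have "norm (ys (\<Psi> x)) \<le> \<bar>C\<bar> * B" if "x \<in> cball 0 1" for x
  proof -
    have "norm (ys (\<Psi> x)) \<le> \<bar>C\<bar> * norm (\<Psi> x)"
      using C[of "\<Psi> x"] mult_right_mono[OF abs_ge_self[of C] norm_ge_zero[of "\<Psi> x"]] by linarith
    also have "\<dots> \<le> \<bar>C\<bar> * B" using B[OF that] by (simp add: mult_left_mono)
    finally show ?thesis .
  qed
  then show ?thesis by (intro linftyI) simp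
qed

lemma small_weak_slice:
  fixes \<Psi> :: "'x::banach \<Rightarrow> 'v"
  assumes \<Psi>: "\<Psi> \<in> linfty" "linfty_norm \<Psi> = 1" "weakly_compact_map smul \<Psi>"
    and e: "0 < e" "e < 1/2"
  obtains S d where "S \<in> weak_slices smul \<Psi>" "1 - e < norm d" "norm d \<le> 1"
    "\<And>x. x \<in> S \<Longrightarrow> \<exists>\<eta>. norm \<eta> = 1 \<and> norm (smul \<eta> (\<Psi> x) - d) \<le> e"
proof -
  let ?T = "weak_topology smul"
  define W where "W = ?T closure_of (\<Psi> ` cball 0 1)"
  define A where "A = (\<lambda>(c, y). smul c y) ` (sphere 0 1 \<times> W)"
  have W: "compactin ?T W" using \<Psi>(3) by (simp add: weakly_compact_map_def W_def)
  have \<Psi>_W: "\<Psi> x \<in> W" if "x \<in> cball 0 1" for x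
    using closure_of_subset[of "\<Psi> ` cball 0 1" ?T] that by (auto simp: W_def topspace_weak)
  have A_I: "smul c w \<in> A" if "norm c = 1" "w \<in> W" for c w
    using that by (force simp: A_def)
  have A_E: "\<exists>c w. norm c = 1 \<and> w \<in> W \<and> y = smul c w" if "y \<in> A" for y
    using that by (force simp: A_def)
  have "compactin ?T A"
    unfolding A_def using W compact_unit_circle[where 'k='k]
    by (intro image_compactin[OF _ scale_continuous_weak]) (simp add: compactin_Times)
  moreover have W1: "norm w \<le> 1" if w: "w \<in> W" for w
  proof -
    obtain g where g: "bounded_linear g" "\<And>x. \<bar>g x\<bar> \<le> norm x" "g w = norm w"
      using norming_functional by blast
    have "\<Psi> ` cball 0 1 \<subseteq> {y. g y \<le> 1}"
    proof clarify
      fix x :: 'x assume "x \<in> cball 0 1"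
      then show "g (\<Psi> x) \<le> 1" using norm_le_linfty_norm[OF \<Psi>(1), of x] \<Psi>(2) g(2)[of "\<Psi> x"] by linarith
    qed
    then have "W \<subseteq> {y. g y \<le> 1}"
      unfolding W_def by (rule closure_of_minimal[OF _ weak.closed_halfspace(2)[OF g(1)]])
    then show ?thesis using w g(3) by auto
  qed
  have A1: "A \<subseteq> cball 0 1"
    using W1 by (auto simp: A_def norm_scale)
  have "1 - e < linfty_norm \<Psi>" using \<Psi>(2) e by simp
  then obtain x0 where x0: "x0 \<in> cball 0 1" "1 - e < norm (\<Psi> x0)" by (rule linfty_norm_gt)
  have "\<Psi> x0 \<in> A" using A_I[of 1 "\<Psi> x0"] \<Psi>_W[OF x0(1)] by simp
  from weak.small_slice[OF \<open>compactin ?T A\<close> A1 this x0(2) e(1)]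
  obtain f :: "'v \<Rightarrow> real" and d \<alpha> where f: "bounded_linear f" and d: "d \<in> A" "1 - e < norm d"
    and \<alpha>: "\<exists>y\<in>A. f y > \<alpha>" "\<And>y. y \<in> A \<Longrightarrow> f y > \<alpha> \<Longrightarrow> norm (y - d) \<le> e" by metis
  have lin: "f (- y) = - f y" for y using linear_neg[OF bounded_linear.linear[OF f]] .
  have minus_d: "- d \<in> A"
  proof -
    obtain c w where "norm c = 1" "w \<in> W" "d = smul c w" using A_E d(1) by blast
    then show ?thesis using A_I[of "- c" w] by simp
  qed
  \<comment> \<open>The weak slice compares moduli, so the level must be nonnegative. If
    \<open>\<alpha>\<close> is negative and \<open>f\<close> vanished at \<open>d\<close>, then
    \<open>- d\<close> would lie in the slice too, giving \<open>2 * norm d \<le> e\<close>,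
    impossible for \<open>e < 1/2\<close>.\<close>
  have "\<exists>y\<in>A. f y > max \<alpha> 0"
  proof (cases "\<alpha> \<ge> 0")
    case True
    then show ?thesis using \<alpha>(1) by (simp add: max_def)
  next
    case False
    have "f (- d) \<noteq> 0"
    proof
      assume "f (- d) = 0"
      then have "norm (- d - d) \<le> e" using \<alpha>(2)[OF minus_d] False by simp
      moreover have "- d - d = (- 2) *\<^sub>R d" by (simp add: scaleR_2)
      ultimately have "2 * norm d \<le> e" by simp
      then show False using d(2) e by simp
    qed
    then have "f d > 0 \<or> f (- d) > 0" using lin[of d] by linarith
    then show ?thesis using False d(1) minus_d by (auto simp: max_def)
  qed
  then obtain c w where cw: "norm c = 1" "w \<in> W" "f (smul c w) > max \<alpha> 0"
    using A_E by metis
  \<comment> \<open>The inequality at \<open>w\<close> is weakly open in \<open>w\<close>, so it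
    already holds at some actual value of \<open>\<Psi>\<close>.\<close>
  have "bounded_linear (\<lambda>v. f (smul c v))"
    by (rule bounded_linear_compose[OF f bounded_linear_scale])
  from weak.open_halfspace(1)[OF this, of "max \<alpha> 0"] cw(2,3)
  obtain x1 where x1: "x1 \<in> cball 0 1" "f (smul c (\<Psi> x1)) > max \<alpha> 0"
    unfolding W_def in_closure_of by (metis (mono_tags, lifting) imageE mem_Collect_eq)
  obtain F and \<rho> :: "'k \<Rightarrow> real" where F: "F \<in> dual_space smul" "\<And>y. \<rho> (F y) = f y"
    "\<And>c. \<rho> c \<le> norm c" "\<And>r. \<rho> (of_real r) = r"
    using real_functional_dual[OF f] by metis
  define s where "s = linfty_norm (F \<circ> \<Psi>)"
  have "norm (F (smul c (\<Psi> x1))) = norm (F (\<Psi> x1))"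
    by (simp add: dual_spaceD(2)[OF F(1)] norm_mult cw(1))
  then have F1: "norm (F (\<Psi> x1)) > max \<alpha> 0"
    using x1(2) F(3)[of "F (smul c (\<Psi> x1))"] F(2)[of "smul c (\<Psi> x1)"] by linarith
  have s: "s > max \<alpha> 0"
    using norm_le_linfty_norm[OF linfty_dual[OF F(1) \<Psi>(1)] x1(1)] F1
    unfolding s_def comp_apply by linarith
  \<comment> \<open>Chosen so that \<open>(1 - \<delta>) * s\<close> is the midpoint of
    \<open>max \<alpha> 0\<close> and \<open>s\<close>.\<close>
  define \<delta> where "\<delta> = (s - max \<alpha> 0) / (2 * s)"
  have s0: "s > 0" using s by simp
  have \<delta>: "0 < \<delta>" "\<delta> < 1" "(1 - \<delta>) * s > max \<alpha> 0"
    using s s0 by (auto simp: \<delta>_def field_simps max_def split: if_splits)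
  have "F (\<Psi> x1) \<noteq> 0" using F1 by auto
  then have "weak_slice (normalized \<Psi> F) \<delta> \<in> weak_slices smul \<Psi>"
    unfolding weak_slices_def using \<delta> F(1) x1(1) by blast
  moreover have "norm d \<le> 1" using A1 d(1) by auto
  moreover have "\<exists>\<eta>. norm \<eta> = 1 \<and> norm (smul \<eta> (\<Psi> x) - d) \<le> e"
    if x: "x \<in> weak_slice (normalized \<Psi> F) \<delta>" for x
  proof -
    have xB: "x \<in> cball 0 1" using x by (simp add: weak_slice_def)
    have "1 - \<delta> \<le> norm (F (\<Psi> x)) / s"
      using x s0 by (simp add: weak_slice_def normalized_def s_def)
    then have "(1 - \<delta>) * s \<le> norm (F (\<Psi> x))" using s0 by (simp add: pos_le_divide_eq)
    then have big: "norm (F (\<Psi> x)) > max \<alpha> 0"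
      using \<delta>(3) by linarith
    obtain \<eta> where \<eta>: "norm \<eta> = 1" "\<eta> * F (\<Psi> x) = of_real (norm (F (\<Psi> x)))"
      by (rule unimodular_rotation)
    have "f (smul \<eta> (\<Psi> x)) = norm (F (\<Psi> x))"
      using F(2)[of "smul \<eta> (\<Psi> x)"] F(4) by (simp add: dual_spaceD(2)[OF F(1)] \<eta>(2))
    then have "norm (smul \<eta> (\<Psi> x) - d) \<le> e"
      using \<alpha>(2)[OF A_I[OF \<eta>(1) \<Psi>_W[OF xB]]] big by simp
    then show ?thesis using \<eta>(1) by blast
  qed
  ultimately show ?thesis using that d(2) by blast
qed

subsection \<open>The alternative Daugavet property on weak slices\<close>

text \<open>The rank-one map \<open>\<Theta>\<close> has norm 1 and values
  \<open>smul (k x) u\<close>. Where the rotated sum nearly attains 2, \<open>k x\<close> must have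
  modulus close to 1, so x lies in the slice and \<open>k x\<close> may be replaced by its
  phase.\<close>

lemma alternative_Daugavet_slice:
  fixes \<Phi> \<Upsilon> :: "'x::banach \<Rightarrow> 'v"
  assumes \<Phi>: "\<Phi> \<in> linfty" "linfty_norm \<Phi> = 1" and \<Upsilon>: "\<Upsilon> \<in> linfty"
    and alt: "alternative_Daugavet smul \<Phi> (dual_tensors smul \<Upsilon>)"
    and S: "S \<in> weak_slices smul \<Upsilon>" and u: "norm u = 1" and e: "0 < e" "e < 1"
  obtains x \<omega> where "x \<in> S" "norm \<omega> = 1" "norm (\<Phi> x + smul \<omega> u) > 2 - e"
proof -
  obtain ys \<mu> where S_eq: "S = weak_slice (normalized \<Upsilon> ys) \<mu>" and \<mu>: "0 < \<mu>" "\<mu> < 1"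
    and ys: "ys \<in> dual_space smul" and nz: "\<exists>x\<in>cball 0 1. ys (\<Upsilon> x) \<noteq> 0"
    using S unfolding weak_slices_def by blast
  define n where "n = linfty_norm (ys \<circ> \<Upsilon>)"
  have le_n: "norm (ys (\<Upsilon> x)) \<le> n" if "x \<in> cball 0 1" for x
    using norm_le_linfty_norm[OF linfty_dual[OF ys \<Upsilon>] that] by (simp add: n_def)
  have n: "n > 0"
  proof -
    obtain x where x: "x \<in> cball 0 1" "ys (\<Upsilon> x) \<noteq> 0" using nz by blast
    have "0 < norm (ys (\<Upsilon> x))" using x(2) by simp
    then show ?thesis using le_n[OF x(1)] by linarith
  qed
  define k where "k = normalized \<Upsilon> ys"
  have k_norm: "norm (k x) = norm (ys (\<Upsilon> x)) / n" for x
    using n by (simp add: k_def normalized_def n_def)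
  define \<Theta> where "\<Theta> = tensor smul (ys \<circ> \<Upsilon>) ((1 / n) *\<^sub>R u)"
  have \<Theta>: "\<Theta> x = smul (k x) u" for x
    by (simp add: \<Theta>_def tensor_def k_def normalized_def n_def scaleR_scale scale_scaleR)
  have \<Theta>_norm: "norm (\<Theta> x) = norm (ys (\<Upsilon> x)) / n" for x
    by (simp add: \<Theta> norm_scale u k_norm)
  have \<Theta>_le: "norm (\<Theta> x) \<le> 1" if "x \<in> cball 0 1" for x
    using le_n[OF that] n by (simp add: \<Theta>_norm)
  have "\<Theta> \<in> linfty" using \<Theta>_le by (rule linftyI)
  have "n \<le> n * linfty_norm \<Theta>"
    unfolding n_def
  proof (rule linfty_norm_le)
    fix x :: 'x assume "x \<in> cball 0 1"
    then have "norm (ys (\<Upsilon> x)) / n \<le> linfty_norm \<Theta>"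
      using norm_le_linfty_norm[OF \<open>\<Theta> \<in> linfty\<close>] by (simp flip: \<Theta>_norm)
    then show "norm ((ys \<circ> \<Upsilon>) x) \<le> linfty_norm (ys \<circ> \<Upsilon>) * linfty_norm \<Theta>"
      using n by (simp add: field_simps n_def)
  qed
  then have "linfty_norm \<Theta> \<ge> 1" using n by simp
  moreover have "linfty_norm \<Theta> \<le> 1" by (rule linfty_norm_le) (rule \<Theta>_le)
  ultimately have "linfty_norm \<Theta> = 1" by simp
  moreover have "\<Theta> \<in> dual_tensors smul \<Upsilon>"
    unfolding dual_tensors_def \<Theta>_def using ys by blast
  ultimately have "2 \<in> rotated_norms smul \<Phi> \<Theta>"
    using alt \<Phi>(2) unfolding alternative_Daugavet_def has_max_def by force
  then obtain \<omega> where \<omega>: "norm \<omega> = 1" "linfty_norm (\<lambda>x. \<Phi> x + smul \<omega> (\<Theta> x)) = 2"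
    unfolding rotated_norms_def by force
  \<comment> \<open>Half of \<open>e\<close> pays for the nearly attained norm and half for the
    change to the phase; the bound by \<open>\<mu>\<close> puts the point into
    \<open>S\<close>.\<close>
  define \<delta> where "\<delta> = min (e / 2) \<mu>"
  have \<delta>: "0 < \<delta>" "\<delta> \<le> e / 2" "\<delta> \<le> \<mu>" using e \<mu> by (auto simp: \<delta>_def)
  obtain x where x: "x \<in> cball 0 1" "2 - \<delta> < norm (\<Phi> x + smul \<omega> (\<Theta> x))"
    using linfty_norm_gt[of "2 - \<delta>" "\<lambda>x. \<Phi> x + smul \<omega> (\<Theta> x)"] \<omega>(2) \<delta>(1) by auto
  have "norm (\<Phi> x) \<le> 1" using norm_le_linfty_norm[OF \<Phi>(1) x(1)] \<Phi>(2) by simp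
  moreover have "norm (\<Phi> x + smul \<omega> (\<Theta> x)) \<le> norm (\<Phi> x) + norm (k x)"
    using norm_triangle_ineq[of "\<Phi> x" "smul \<omega> (\<Theta> x)"] by (simp add: \<Theta> norm_scale \<omega>(1) u norm_mult)
  ultimately have k_gt: "norm (k x) > 1 - \<delta>" using x(2) by linarith
  have k_le: "norm (k x) \<le> 1" using \<Theta>_le[OF x(1)] by (simp add: \<Theta>_norm k_norm)
  have "x \<in> S" using k_gt \<delta>(3) x(1) by (simp add: S_eq weak_slice_def k_def)
  have k0: "norm (k x) > 0" using k_gt \<delta>(2) e by linarith
  define \<kappa> where "\<kappa> = (1 / norm (k x)) *\<^sub>R k x"
  have \<kappa>: "norm \<kappa> = 1" using k0 by (simp add: \<kappa>_def)
  have "k x = norm (k x) *\<^sub>R \<kappa>" using k0 by (simp add: \<kappa>_def)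
  then have "smul \<omega> (\<Theta> x) = norm (k x) *\<^sub>R smul (\<omega> * \<kappa>) u"
    by (metis \<Theta> scaleR_scale scale_scaleR scale_scale)
  then have "smul (\<omega> * \<kappa>) u - smul \<omega> (\<Theta> x) = (1 - norm (k x)) *\<^sub>R smul (\<omega> * \<kappa>) u"
    by (simp add: scaleR_left_diff_distrib)
  then have "norm (smul (\<omega> * \<kappa>) u - smul \<omega> (\<Theta> x)) = 1 - norm (k x)"
    using k_le by (simp add: norm_scale norm_mult \<omega>(1) \<kappa> u)
  moreover have "norm (\<Phi> x + smul \<omega> (\<Theta> x))
      \<le> norm (\<Phi> x + smul (\<omega> * \<kappa>) u) + norm (smul (\<omega> * \<kappa>) u - smul \<omega> (\<Theta> x))"
    using norm_triangle_ineq4[of "\<Phi> x + smul (\<omega> * \<kappa>) u" "smul (\<omega> * \<kappa>) u - smul \<omega> (\<Theta> x)"] by simp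
  ultimately have "norm (\<Phi> x + smul (\<omega> * \<kappa>) u) > 2 - e"
    using x(2) k_gt \<delta>(2) by linarith
  moreover have "norm (\<omega> * \<kappa>) = 1" by (simp add: norm_mult \<omega>(1) \<kappa>)
  ultimately show ?thesis using that \<open>x \<in> S\<close> by blast
qed

section \<open>Attainment over the unit circle\<close>

lemma rotated_norms_attained:
  fixes \<Phi> \<Psi> :: "'x::banach \<Rightarrow> 'v"
  assumes \<Phi>: "\<Phi> \<in> linfty" and \<Psi>: "\<Psi> \<in> linfty" "linfty_norm \<Psi> \<le> 1"
  obtains \<omega> where "norm \<omega> = 1"
    "\<And>\<omega>'. norm \<omega>' = 1 \<Longrightarrow> linfty_norm (\<lambda>x. \<Phi> x + smul \<omega>' (\<Psi> x)) \<le> linfty_norm (\<lambda>x. \<Phi> x + smul \<omega> (\<Psi> x))"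
proof -
  define G where "G \<omega> = linfty_norm (\<lambda>x. \<Phi> x + smul \<omega> (\<Psi> x))" for \<omega>
  have \<Psi>_le: "norm (\<Psi> x) \<le> 1" if "x \<in> cball 0 1" for x
    using norm_le_linfty_norm[OF \<Psi>(1) that] \<Psi>(2) by simp
  have mem: "(\<lambda>x. \<Phi> x + smul \<omega> (\<Psi> x)) \<in> linfty" for \<omega>
  proof -
    have "norm (\<Phi> x + smul \<omega> (\<Psi> x)) \<le> linfty_norm \<Phi> + norm \<omega>" if "x \<in> cball 0 1" for x
    proof (rule norm_triangle_le)
      have "norm \<omega> * norm (\<Psi> x) \<le> norm \<omega>" using \<Psi>_le[OF that] by (simp add: mult_left_le)
      then show "norm (\<Phi> x) + norm (smul \<omega> (\<Psi> x)) \<le> linfty_norm \<Phi> + norm \<omega>"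
        using norm_le_linfty_norm[OF \<Phi> that] by (simp add: norm_scale)
    qed
    then show ?thesis by (rule linftyI)
  qed
  \<comment> \<open>Since \<open>\<Psi>\<close> has norm at most 1, the norm of the rotated sum is
    1-Lipschitz in the rotation, which gives continuity.\<close>
  have lip: "G \<omega> \<le> G \<omega>' + dist \<omega> \<omega>'" for \<omega> \<omega>'
    unfolding G_def
  proof (rule linfty_norm_le)
    fix x :: 'x assume x: "x \<in> cball 0 1"
    have "\<Phi> x + smul \<omega> (\<Psi> x) = (\<Phi> x + smul \<omega>' (\<Psi> x)) + smul (\<omega> - \<omega>') (\<Psi> x)"
      by (simp add: scale_left_diff_distrib)
    also have "norm \<dots> \<le> norm (\<Phi> x + smul \<omega>' (\<Psi> x)) + norm (\<omega> - \<omega>') * norm (\<Psi> x)"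
      by (metis norm_scale norm_triangle_ineq)
    also have "\<dots> \<le> G \<omega>' + dist \<omega> \<omega>'"
      using norm_le_linfty_norm[OF mem x, of \<omega>'] mult_left_le[OF \<Psi>_le[OF x], of "norm (\<omega> - \<omega>')"]
      by (simp add: G_def dist_norm)
    finally show "norm (\<Phi> x + smul \<omega> (\<Psi> x)) \<le> linfty_norm (\<lambda>x. \<Phi> x + smul \<omega>' (\<Psi> x)) + dist \<omega> \<omega>'"
      by (simp add: G_def)
  qed
  have "dist (G \<omega>) (G \<omega>') \<le> dist \<omega> \<omega>'" for \<omega> \<omega>'
    using lip[of \<omega> \<omega>'] lip[of \<omega>' \<omega>] by (simp add: dist_real_def dist_commute abs_le_iff)
  then have "continuous_on (sphere 0 1) G"
    unfolding continuous_on_iff by (meson le_less_trans)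
  moreover have "sphere 0 1 \<noteq> ({} :: 'k set)"
    using norm_one[where 'a='k] by (metis dist_0_norm empty_iff mem_sphere)
  ultimately obtain \<omega> where "\<omega> \<in> sphere 0 1" "\<forall>\<omega>'\<in>sphere 0 1. G \<omega>' \<le> G \<omega>"
    using continuous_attains_sup[OF compact_unit_circle] by blast
  then show ?thesis using that[of \<omega>] by (simp add: G_def)
qed

end

theorem theorem4p10:
  fixes smulX :: "'k::real_or_complex \<Rightarrow> 'x::banach \<Rightarrow> 'x"
    and smulY :: "'k \<Rightarrow> 'y::banach \<Rightarrow> 'y"
    and \<Phi> \<Upsilon> \<Psi> :: "'x \<Rightarrow> 'y"
  assumes "K_banach smulX"
    and "K_banach smulY"
    and "\<Phi> \<in> linfty" and "\<Upsilon> \<in> linfty" and "\<Psi> \<in> linfty"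
    and "linfty_norm \<Phi> = 1" and "linfty_norm \<Upsilon> = 1" and "linfty_norm \<Psi> = 1"
    and "alternative_Daugavet smulY \<Phi> (dual_tensors smulY \<Upsilon>)"
    and "weakly_slice_continuous smulY \<Psi> \<Upsilon>"
    and "weakly_compact_map smulY \<Psi>"
  shows "has_max (rotated_norms smulY \<Phi> \<Psi>) 2"
proof -
  interpret K_banach smulY by fact
  define G where "G \<omega> = linfty_norm (\<lambda>x. \<Phi> x + smulY \<omega> (\<Psi> x))" for \<omega>
  have pointwise: "norm (\<Phi> x + smulY \<omega> (\<Psi> x)) \<le> 2" if "norm \<omega> = 1" "x \<in> cball 0 1" for \<omega> x
    using norm_triangle_ineq[of "\<Phi> x" "smulY \<omega> (\<Psi> x)"] norm_le_linfty_norm[OF assms(3) that(2)]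
      norm_le_linfty_norm[OF assms(5) that(2)] assms(6,8) that(1) by (simp add: norm_scale)
  have upper: "G \<omega> \<le> 2" if "norm \<omega> = 1" for \<omega>
    unfolding G_def by (rule linfty_norm_le) (rule pointwise[OF that])
  obtain \<omega>0 where \<omega>0: "norm \<omega>0 = 1" "\<And>\<omega>. norm \<omega> = 1 \<Longrightarrow> G \<omega> \<le> G \<omega>0"
    using rotated_norms_attained[OF assms(3,5)] assms(8) unfolding G_def by auto
  \<comment> \<open>The three errors \<open>e\<close> come from the Daugavet estimate, from
    normalizing \<open>d\<close> to \<open>u\<close>, and from replacing \<open>d\<close> by the
    rotated value of \<open>\<Psi>\<close>.\<close>
  have approx: "G \<omega>0 \<ge> 2 - 3 * e" if e: "0 < e" "e < 1/2" for e
  proof -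
    obtain S d where S: "S \<in> weak_slices smulY \<Psi>" and d: "1 - e < norm d" "norm d \<le> 1"
      and near: "\<And>x. x \<in> S \<Longrightarrow> \<exists>\<eta>. norm \<eta> = 1 \<and> norm (smulY \<eta> (\<Psi> x) - d) \<le> e"
      using small_weak_slice[OF assms(5,8,11) e] by blast
    obtain R where R: "R \<in> weak_slices smulY \<Upsilon>" "R \<subseteq> S"
      using assms(10) S unfolding weakly_slice_continuous_def by blast
    define u where "u = (1 / norm d) *\<^sub>R d"
    have "norm d > 0" using d(1) e by linarith
    then have u: "norm u = 1" "d = norm d *\<^sub>R u" by (auto simp: u_def)
    have "norm (u - d) = norm ((1 - norm d) *\<^sub>R u)"
      using u(2) by (simp add: scaleR_left_diff_distrib)
    then have ud: "norm (u - d) \<le> e" using u(1) d by simp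
    have "e < 1" using e by simp
    from alternative_Daugavet_slice[OF assms(3,6,4,9) R(1) u(1) e(1) this]
    obtain x \<omega> where x: "x \<in> R" and \<omega>: "norm \<omega> = 1" "norm (\<Phi> x + smulY \<omega> u) > 2 - e" by blast
    obtain \<eta> where \<eta>: "norm \<eta> = 1" "norm (smulY \<eta> (\<Psi> x) - d) \<le> e"
      using near x R(2) by blast
    have xB: "x \<in> cball 0 1" using x R(1) by (auto simp: weak_slices_def weak_slice_def)
    have "smulY \<omega> u - smulY (\<omega> * \<eta>) (\<Psi> x) = smulY \<omega> ((u - d) - (smulY \<eta> (\<Psi> x) - d))"
      by (simp add: scale_right_diff_distrib)
    then have "norm (smulY \<omega> u - smulY (\<omega> * \<eta>) (\<Psi> x)) = norm ((u - d) - (smulY \<eta> (\<Psi> x) - d))"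
      using \<omega>(1) by (simp add: norm_scale)
    also have "\<dots> \<le> 2 * e"
      using norm_triangle_ineq4[of "u - d" "smulY \<eta> (\<Psi> x) - d"] ud \<eta>(2) by linarith
    finally have "norm (\<Phi> x + smulY (\<omega> * \<eta>) (\<Psi> x)) \<ge> 2 - 3 * e"
      using \<omega>(2) norm_triangle_ineq[of "\<Phi> x + smulY (\<omega> * \<eta>) (\<Psi> x)" "smulY \<omega> u - smulY (\<omega> * \<eta>) (\<Psi> x)"]
      by simp
    also have "norm (\<Phi> x + smulY (\<omega> * \<eta>) (\<Psi> x)) \<le> G (\<omega> * \<eta>)"
      unfolding G_def
    proof (rule norm_le_linfty_norm[OF _ xB])
      show "(\<lambda>x. \<Phi> x + smulY (\<omega> * \<eta>) (\<Psi> x)) \<in> linfty"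
        using pointwise[of "\<omega> * \<eta>"] \<omega>(1) \<eta>(1) by (intro linftyI) (simp add: norm_mult)
    qed
    also have "\<dots> \<le> G \<omega>0" using \<omega>0(2) \<omega>(1) \<eta>(1) by (simp add: norm_mult)
    finally show ?thesis .
  qed
  have "2 \<le> G \<omega>0"
  proof (rule field_le_epsilon)
    fix e :: real assume "e > 0"
    \<comment> \<open>The cap 1/3 keeps the argument of \<open>approx\<close> below 1/2.\<close>
    then have "G \<omega>0 \<ge> 2 - 3 * min (e/3) (1/3)" by (intro approx) auto
    then show "2 \<le> G \<omega>0 + e" by simp
  qed
  then have "G \<omega>0 = 2" using upper[OF \<omega>0(1)] by simp
  then show ?thesis
    unfolding has_max_def rotated_norms_def using \<omega>0(1) upper by (auto simp: G_def)
qed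

end
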